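(* Let $(X,\mathcal B,\mu)$ be a separable probability space. Suppose that $T_1,\dots,T_\ell$ are distinct and different from the identity transformations belonging to a totally weak mixing free finitely generated abelian group $G$ acting on $(X,\mathcal B,\mu)$ by measure preserving transformations. Let $\hat T_1,\dots,\hat T_\ell$ be invertible $\mu$-preserving transformations of $X$ which commute with each other and with $T_1,\dots,T_\ell$. Then for any bounded measurable functions $f_1,\dots,f_\ell$ on $X$, $$\lim_{N\to\infty}\frac 1N\sum_{n=0}^N\prod_{j=1}^\ell T_j^n\hat T_j^Nf_j=\prod_{j=1}^\ell\int f_j\,d\mu\quad\text{in } L^2(X,\mu).$$
   Context: For a transformation $T$ and a function $f$ on $X$, $Tf$ denotes $Tf(x)=f(Tx)$. A measure preserving transformation $T$ of $(X,\mathcal B,\mu)$ is weakly mixing if $T\times T$ is ergodic with respect to $\mu\times\mu$. The group $G$ is totally weak mixing if all its elements other than the identity are weakly mixing transformations. *)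

theory Defs
  imports
    "HOL-Probability.Probability"
    "HOL-Algebra.Group_Action"
    "HOL-Algebra.Free_Abelian_Groups"
begin

section \<open>Measure preserving transformations\<close>

text \<open>Separability of the measure algebra for the metric \<open>\<mu>(A \<triangle> B)\<close>; for a probability measure this
  is separability of \<open>L\<^sup>2\<close>, and it holds in particular whenever the sigma-algebra is countably
  generated up to null sets.\<close>

definition separable_measure :: "'a measure \<Rightarrow> bool" where
  "separable_measure M \<longleftrightarrow>
     (\<exists>\<C>\<subseteq>sets M. countable \<C> \<and>
        (\<forall>A\<in>sets M. \<forall>e>0. \<exists>B\<in>\<C>. emeasure M ((A - B) \<union> (B - A)) < e))"

text \<open>Only the restriction of a transformation to \<open>space M\<close> matters throughout.\<close>

definition measure_preserving :: "'a measure \<Rightarrow> ('a \<Rightarrow> 'a) \<Rightarrow> bool" where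
  "measure_preserving M T \<longleftrightarrow>
     T \<in> M \<rightarrow>\<^sub>M M \<and> (\<forall>A\<in>sets M. emeasure M (T -` A \<inter> space M) = emeasure M A)"

definition invertible_measure_preserving :: "'a measure \<Rightarrow> ('a \<Rightarrow> 'a) \<Rightarrow> bool" where
  "invertible_measure_preserving M T \<longleftrightarrow>
     measure_preserving M T \<and>
     (\<exists>S. measure_preserving M S \<and> (\<forall>x\<in>space M. S (T x) = x \<and> T (S x) = x))"

definition ergodic :: "'a measure \<Rightarrow> ('a \<Rightarrow> 'a) \<Rightarrow> bool" where
  "ergodic M T \<longleftrightarrow>
     measure_preserving M T \<and>
     (\<forall>A\<in>sets M. T -` A \<inter> space M = A \<longrightarrow> emeasure M A = 0 \<or> emeasure M (space M - A) = 0)"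

definition weakly_mixing :: "'a measure \<Rightarrow> ('a \<Rightarrow> 'a) \<Rightarrow> bool" where
  "weakly_mixing M T \<longleftrightarrow>
     measure_preserving M T \<and> ergodic (M \<Otimes>\<^sub>M M) (map_prod T T)"

definition commute_on :: "'a set \<Rightarrow> ('a \<Rightarrow> 'a) \<Rightarrow> ('a \<Rightarrow> 'a) \<Rightarrow> bool" where
  "commute_on X S T \<longleftrightarrow> (\<forall>x\<in>X. S (T x) = T (S x))"

section \<open>Groups of transformations\<close>

text \<open>A basis of a free abelian group lies in the group itself, so no generality is lost by
  indexing it by elements of the type underlying \<open>G\<close>.\<close>

definition free_abelian :: "('g, 'm) monoid_scheme \<Rightarrow> bool" where
  "free_abelian G \<longleftrightarrow> comm_group G \<and> (\<exists>B::'g set. G \<cong> free_Abelian_group B)"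

definition finitely_generated :: "('g, 'm) monoid_scheme \<Rightarrow> bool" where
  "finitely_generated G \<longleftrightarrow> (\<exists>S. finite S \<and> S \<subseteq> carrier G \<and> generate G S = carrier G)"

definition measure_preserving_action ::
    "('g, 'm) monoid_scheme \<Rightarrow> 'a measure \<Rightarrow> ('g \<Rightarrow> 'a \<Rightarrow> 'a) \<Rightarrow> bool" where
  "measure_preserving_action G M \<phi> \<longleftrightarrow>
     group_action G (space M) \<phi> \<and> (\<forall>g\<in>carrier G. measure_preserving M (\<phi> g))"

definition totally_weak_mixing ::
    "('g, 'm) monoid_scheme \<Rightarrow> 'a measure \<Rightarrow> ('g \<Rightarrow> 'a \<Rightarrow> 'a) \<Rightarrow> bool" where
  "totally_weak_mixing G M \<phi> \<longleftrightarrow>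
     (\<forall>g\<in>carrier G. g \<noteq> \<one>\<^bsub>G\<^esub> \<longrightarrow> weakly_mixing M (\<phi> g))"

section \<open>Convergence in the space of square integrable functions\<close>

definition square_integrable :: "'a measure \<Rightarrow> ('a \<Rightarrow> complex) \<Rightarrow> bool" where
  "square_integrable M f \<longleftrightarrow>
     f \<in> borel_measurable M \<and> integrable M (\<lambda>x. (norm (f x))\<^sup>2)"

definition tendsto_L2 :: "'a measure \<Rightarrow> (nat \<Rightarrow> 'a \<Rightarrow> complex) \<Rightarrow> ('a \<Rightarrow> complex) \<Rightarrow> bool" where
  "tendsto_L2 M F h \<longleftrightarrow>
     (\<forall>N. square_integrable M (F N)) \<and> square_integrable M h \<and>
     (\<lambda>N. sqrt (\<integral>x. (norm (F N x - h x))\<^sup>2 \<partial>M)) \<longlonglongrightarrow> 0"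

end

theory Submission
  imports Defs
begin

text \<open>
  Write \<open>P\<^sub>j = T\<^sub>j\<^sup>n S\<^sub>j\<^sup>N\<close> for the maps in the averages, where \<open>S\<^sub>j\<close> is the extra invertible map
  attached to \<open>T\<^sub>j\<close>. The proof is an induction over the set \<open>J\<close> of indices of the statement that
  the averages over \<open>n < N\<close> of \<open>\<integral> \<Prod>\<^sub>j f\<^sub>j \<circ> P\<^sub>j\<close> tend to \<open>\<Prod>\<^sub>j \<integral> f\<^sub>j\<close>, for all bounded \<open>f\<^sub>j\<close>
  (\<open>jointly_mixing\<close>).

  To add an index \<open>i\<close>, change variables by \<open>P\<^sub>i\<^sup>-\<^sup>1\<close>. It is then enough that the averages of
  \<open>w\<^sub>n = \<Prod>\<^sub>j f\<^sub>j \<circ> P\<^sub>j P\<^sub>i\<^sup>-\<^sup>1\<close> converge to the constant \<open>c = \<Prod>\<^sub>j \<integral> f\<^sub>j\<close> in \<open>L\<^sup>2\<close>, and for this the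
  van der Corput argument (\<open>van_der_Corput\<close>) only asks for the averages of the correlations
  \<open>\<integral> w\<^sub>n\<^sub>+\<^sub>h cnj w\<^sub>n\<^sub>+\<^sub>k\<close>. Replacing \<open>n\<close> by \<open>n + h\<close> multiplies \<open>P\<^sub>j P\<^sub>i\<^sup>-\<^sup>1\<close> by the \<open>h\<close>-th power of
  \<open>R\<^sub>j = T\<^sub>j T\<^sub>i\<^sup>-\<^sup>1\<close>, because everything commutes; so these correlations are integrals of the same
  kind over \<open>J\<close>, for the functions \<open>f\<^sub>j \<circ> R\<^sub>j\<^sup>h \<sqdot> cnj (f\<^sub>j \<circ> R\<^sub>j\<^sup>k)\<close>, and the induction hypothesis
  computes their limit as \<open>\<Prod>\<^sub>j \<integral> f\<^sub>j \<circ> R\<^sub>j\<^sup>h \<sqdot> cnj (f\<^sub>j \<circ> R\<^sub>j\<^sup>k)\<close>. The group elements \<open>T\<^sub>i\<close> and \<open>T\<^sub>j\<close>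
  are distinct, hence \<open>R\<^sub>j\<close> is weakly mixing, and the average of that product over \<open>h, k < H\<close> tends
  to \<open>|c|\<^sup>2\<close> as \<open>H\<close> grows (\<open>weakly_mixing_correlations\<close>). This is what makes \<open>w\<^sub>n - c\<close> average to
  zero. The theorem itself is the \<open>L\<^sup>2\<close> convergence of the \<open>w\<^sub>n\<close> when an index \<open>0\<close> carrying the
  identity is added to the family.

  Weak mixing enters through one fact only: with \<open>g = f - \<integral> f\<close> and \<open>F(x, y) = g(x) cnj g(y)\<close>, the
  square of \<open>|\<integral> g \<circ> R\<^sup>h \<sqdot> cnj (g \<circ> R\<^sup>k)|\<close> is the correlation of \<open>F \<circ> Q\<^sup>h\<close> and \<open>F \<circ> Q\<^sup>k\<close> for the ergodic
  map \<open>Q = R \<times> R\<close>, so that its double average is the squared norm of an ergodic average of \<open>F\<close>. The mean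
  ergodic theorem for bounded functions follows from pointwise convergence by dominated convergence,
  and pointwise convergence from a maximal inequality argument (\<open>ergodic_sums_bounded_above\<close>).
\<close>

section \<open>Bounded measurable functions and measure preserving maps\<close>

text \<open>The bound is required on \<open>space M\<close> only, since nothing is known about the functions elsewhere.\<close>

definition bounded_measurable :: "'a measure \<Rightarrow> ('a \<Rightarrow> 'b::real_normed_vector) \<Rightarrow> bool" where
  "bounded_measurable M f \<longleftrightarrow> f \<in> borel_measurable M \<and> (\<exists>B. \<forall>x\<in>space M. norm (f x) \<le> B)"

lemma bounded_measurableI:
  "f \<in> borel_measurable M \<Longrightarrow> (\<And>x. x \<in> space M \<Longrightarrow> norm (f x) \<le> B) \<Longrightarrow> bounded_measurable M f"
  by (auto simp: bounded_measurable_def)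

lemma bounded_measurable_measurable: "bounded_measurable M f \<Longrightarrow> f \<in> borel_measurable M"
  by (auto simp: bounded_measurable_def)

lemma bounded_measurable_bound:
  assumes "bounded_measurable M f"
  obtains B where "B > 0" "\<And>x. x \<in> space M \<Longrightarrow> norm (f x) \<le> B"
proof -
  obtain B where "\<forall>x\<in>space M. norm (f x) \<le> B"
    using assms by (auto simp: bounded_measurable_def)
  then have "\<And>x. x \<in> space M \<Longrightarrow> norm (f x) \<le> max B 1" by fastforce
  then show thesis by (intro that[of "max B 1"]) auto
qed

lemma bounded_measurable_const: "bounded_measurable M (\<lambda>x. c)"
  by (auto simp: bounded_measurable_def)

lemma bounded_measurable_diff:
  fixes f g :: "'a \<Rightarrow> 'b::{real_normed_vector, second_countable_topology}"
  assumes "bounded_measurable M f" "bounded_measurable M g"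
  shows "bounded_measurable M (\<lambda>x. f x - g x)"
proof -
  obtain A B where "\<And>x. x \<in> space M \<Longrightarrow> norm (f x) \<le> A" "\<And>x. x \<in> space M \<Longrightarrow> norm (g x) \<le> B"
    using assms[THEN bounded_measurable_bound] by metis
  then show ?thesis
    using assms[THEN bounded_measurable_measurable]
    by (intro bounded_measurableI[where B = "A + B"])
       (auto intro: norm_triangle_le_diff add_mono)
qed

lemma bounded_measurable_mult:
  fixes f g :: "'a \<Rightarrow> 'b::{real_normed_field, second_countable_topology}"
  assumes "bounded_measurable M f" "bounded_measurable M g"
  shows "bounded_measurable M (\<lambda>x. f x * g x)"
proof -
  obtain A B where "A > 0" "B > 0" "\<And>x. x \<in> space M \<Longrightarrow> norm (f x) \<le> A"
      "\<And>x. x \<in> space M \<Longrightarrow> norm (g x) \<le> B"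
    using assms[THEN bounded_measurable_bound] by metis
  then show ?thesis
    using assms[THEN bounded_measurable_measurable]
    by (intro bounded_measurableI[where B = "A * B"]) (auto simp: norm_mult intro!: mult_mono)
qed

lemma bounded_measurable_prod:
  fixes f :: "'i \<Rightarrow> 'a \<Rightarrow> 'b::{real_normed_field, second_countable_topology}"
  assumes "\<And>j. j \<in> J \<Longrightarrow> bounded_measurable M (f j)"
  shows "bounded_measurable M (\<lambda>x. \<Prod>j\<in>J. f j x)"
  using assms
  by (induction J rule: infinite_finite_induct)
     (auto intro: bounded_measurable_mult bounded_measurable_const)

lemma bounded_measurable_sum:
  fixes f :: "'i \<Rightarrow> 'a \<Rightarrow> 'b::{real_normed_vector, second_countable_topology}"
  assumes "\<And>j. j \<in> J \<Longrightarrow> bounded_measurable M (f j)"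
  shows "bounded_measurable M (\<lambda>x. \<Sum>j\<in>J. f j x)"
  using assms
proof (induction J rule: infinite_finite_induct)
  case (insert j J)
  have "bounded_measurable M (\<lambda>x. f j x - (0 - (\<Sum>j\<in>J. f j x)))"
    by (intro bounded_measurable_diff bounded_measurable_const insert) (use insert in auto)
  then show ?case using insert by simp
qed (auto intro: bounded_measurable_const)

lemma bounded_measurable_cnj:
  "bounded_measurable M f \<Longrightarrow> bounded_measurable M (\<lambda>x. cnj (f x))"
  unfolding bounded_measurable_def
  by (auto intro: measurable_compose[OF _ borel_measurable_continuous_onI] continuous_intros)

lemma bounded_measurable_cmod_square:
  fixes f :: "'a \<Rightarrow> complex"
  assumes "bounded_measurable M f"
  shows "bounded_measurable M (\<lambda>x. (cmod (f x))\<^sup>2)"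
proof -
  have "bounded_measurable M (\<lambda>x. cmod (f x))"
    using assms by (auto simp: bounded_measurable_def)
  from bounded_measurable_mult[OF this this] show ?thesis by (simp add: power2_eq_square)
qed

lemma (in finite_measure) integrable_bounded_measurable:
  fixes f :: "'a \<Rightarrow> 'b::{banach, second_countable_topology}"
  shows "bounded_measurable M f \<Longrightarrow> integrable M f"
  by (auto simp: bounded_measurable_def intro!: integrable_const_bound)

lemma (in prob_space) bounded_measurable_integral_bound:
  fixes f :: "'a \<Rightarrow> 'b::{banach, second_countable_topology}"
  assumes "bounded_measurable M f" "\<And>x. x \<in> space M \<Longrightarrow> norm (f x) \<le> B"
  shows "norm (\<integral>x. f x \<partial>M) \<le> B"
proof -
  have "norm (\<integral>x. f x \<partial>M) \<le> (\<integral>x. norm (f x) \<partial>M)" by simp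
  also have "\<dots> \<le> (\<integral>x. B \<partial>M)"
    using assms by (intro integral_mono integrable_norm integrable_bounded_measurable)
       (auto simp: bounded_measurable_const)
  finally show ?thesis by (simp add: prob_space)
qed

lemma measure_preserving_measurable: "measure_preserving M T \<Longrightarrow> T \<in> M \<rightarrow>\<^sub>M M"
  by (simp add: measure_preserving_def)

lemma measure_preserving_in_space:
  "measure_preserving M T \<Longrightarrow> x \<in> space M \<Longrightarrow> T x \<in> space M"
  by (auto simp: measure_preserving_def dest: measurable_space)

lemma measure_preserving_distr:
  assumes "measure_preserving M T"
  shows "distr M M T = M"
  using assms by (intro measure_eqI) (auto simp: measure_preserving_def emeasure_distr)

lemma measure_preserving_integral:
  fixes f :: "'a \<Rightarrow> 'b::{banach, second_countable_topology}"
  assumes "measure_preserving M T" "f \<in> borel_measurable M"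
  shows "(\<integral>x. f (T x) \<partial>M) = (\<integral>x. f x \<partial>M)"
  using integral_distr[OF measure_preserving_measurable[OF assms(1)] assms(2)]
  by (simp add: measure_preserving_distr[OF assms(1)])

lemma bounded_measurable_compose:
  assumes "measure_preserving M T" "bounded_measurable M f"
  shows "bounded_measurable M (\<lambda>x. f (T x))"
proof -
  obtain B where B: "\<And>x. x \<in> space M \<Longrightarrow> norm (f x) \<le> B"
    using bounded_measurable_bound[OF assms(2)] by blast
  show ?thesis
  proof (rule bounded_measurableI[where B = B])
    show "(\<lambda>x. f (T x)) \<in> borel_measurable M"
      by (rule measurable_compose[OF measure_preserving_measurable[OF assms(1)]
            bounded_measurable_measurable[OF assms(2)]])
    show "norm (f (T x)) \<le> B" if "x \<in> space M" for x
      by (rule B[OF measure_preserving_in_space[OF assms(1) that]])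
  qed
qed

lemma measure_preserving_id: "measure_preserving M (\<lambda>x. x)"
proof -
  have "(\<lambda>x. x) -` A \<inter> space M = A" if "A \<in> sets M" for A
    using sets.sets_into_space[OF that] by auto
  then show ?thesis by (auto simp: measure_preserving_def)
qed

lemma measure_preserving_comp:
  assumes S: "measure_preserving M S" and T: "measure_preserving M T"
  shows "measure_preserving M (\<lambda>x. S (T x))"
proof -
  have "emeasure M ((\<lambda>x. S (T x)) -` A \<inter> space M) = emeasure M A" if A: "A \<in> sets M" for A
  proof -
    have "(\<lambda>x. S (T x)) -` A \<inter> space M = T -` (S -` A \<inter> space M) \<inter> space M"
      using measure_preserving_in_space[OF T] by auto
    moreover have "S -` A \<inter> space M \<in> sets M"
      using S A by (auto simp: measure_preserving_def)
    ultimately show ?thesis using S T A by (simp add: measure_preserving_def del: vimage_Int)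
  qed
  then show ?thesis
    using measurable_compose[OF T[THEN measure_preserving_measurable]
        S[THEN measure_preserving_measurable]]
    by (auto simp: measure_preserving_def)
qed

lemma measure_preserving_funpow:
  assumes "measure_preserving M T"
  shows "measure_preserving M (\<lambda>x. (T ^^ n) x)"
proof (induction n)
  case 0 show ?case by (simp add: measure_preserving_id)
next
  case (Suc n) from measure_preserving_comp[OF assms this] show ?case by simp
qed

section \<open>The ergodic theorem for bounded functions\<close>

text \<open>The maximum of the sums of \<open>f\<close> along the first \<open>0, \<dots>, n\<close> points of the orbit of \<open>x\<close>, in the
  recursive form that compares the maximum at \<open>x\<close> with the one at \<open>T x\<close>.\<close>

primrec max_partial_sum :: "('a \<Rightarrow> real) \<Rightarrow> ('a \<Rightarrow> 'a) \<Rightarrow> nat \<Rightarrow> 'a \<Rightarrow> real" where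
  "max_partial_sum f T 0 = (\<lambda>x. 0)"
| "max_partial_sum f T (Suc n) = (\<lambda>x. max 0 (f x + max_partial_sum f T n (T x)))"

lemma max_partial_sum_nonneg: "max_partial_sum f T n x \<ge> 0"
  by (cases n) auto

lemma max_partial_sum_mono: "max_partial_sum f T n x \<le> max_partial_sum f T (Suc n) x"
proof (induction n arbitrary: x)
  case (Suc n)
  have "f x + max_partial_sum f T n (T x) \<le> f x + max_partial_sum f T (Suc n) (T x)"
    using Suc by simp
  then show ?case
    unfolding max_partial_sum.simps(2)[of _ _ "Suc n"] max_partial_sum.simps(2)[of _ _ n]
    by (intro max.mono) auto
qed simp

lemma sum_orbit_Suc:
  "(\<Sum>k<Suc n. f ((T ^^ k) x)) = f x + (\<Sum>k<n. f ((T ^^ k) (T x)))"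
  by (simp add: sum.lessThan_Suc_shift funpow_Suc_right del: sum.lessThan_Suc funpow.simps(2))

lemma sum_le_max_partial_sum: "(\<Sum>k<n. f ((T ^^ k) x)) \<le> max_partial_sum f T n x"
proof (induction n arbitrary: x)
  case (Suc n)
  show ?case unfolding sum_orbit_Suc using Suc[of "T x"] by auto
qed simp

lemma bounded_measurable_max_partial_sum:
  assumes T: "measure_preserving M T" and f: "bounded_measurable M f"
  shows "bounded_measurable M (max_partial_sum f T n)"
proof (induction n)
  case (Suc n)
  have "bounded_measurable M (\<lambda>x. f x - (0 - max_partial_sum f T n (T x)))"
    by (intro bounded_measurable_diff bounded_measurable_const f
        bounded_measurable_compose[OF T] Suc)
  then have *: "bounded_measurable M (\<lambda>x. f x + max_partial_sum f T n (T x))" by simp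
  obtain B where "B > 0"
      "\<And>x. x \<in> space M \<Longrightarrow> norm (f x + max_partial_sum f T n (T x)) \<le> B"
    using bounded_measurable_bound[OF *] by blast
  with bounded_measurable_measurable[OF *] show ?case
    by (intro bounded_measurableI[where B = B]) fastforce+
qed (simp add: bounded_measurable_const)

text \<open>The set \<open>E\<close> where the sums are unbounded above is invariant. If it had full measure, the
  running maxima \<open>m\<^sub>n\<close> would increase to infinity almost everywhere, so
  \<open>m\<^sub>n\<^sub>+\<^sub>1 - m\<^sub>n \<circ> T = max (- m\<^sub>n \<circ> T) f\<close> would converge to \<open>f\<close>. But \<open>m\<^sub>n \<circ> T\<close> and \<open>m\<^sub>n\<close> have the same
  integral, so the integrals of these functions are nonnegative, and that of \<open>f\<close> is not.\<close>

lemma (in prob_space) ergodic_sums_bounded_above: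
  fixes f :: "'a \<Rightarrow> real"
  assumes erg: "ergodic M T" and f: "bounded_measurable M f" and neg: "(\<integral>x. f x \<partial>M) < 0"
  shows "AE x in M. \<exists>C. \<forall>n. (\<Sum>k<n. f ((T ^^ k) x)) \<le> C"
proof -
  have T: "measure_preserving M T" using erg by (simp add: ergodic_def)
  define S where "S n x = (\<Sum>k<n. f ((T ^^ k) x))" for n x
  define E where "E = {x \<in> space M. \<forall>C::nat. \<exists>n. S n x > real C}"
  let ?m = "max_partial_sum f T"
  have [measurable]: "S n \<in> borel_measurable M" for n
    unfolding S_def
    by (intro borel_measurable_sum bounded_measurable_measurable bounded_measurable_compose[OF _ f]
        measure_preserving_funpow T)
  have E: "E \<in> sets M" unfolding E_def by measurable
  have S_Suc: "S (Suc n) x = f x + S n (T x)" for n x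
    unfolding S_def by (rule sum_orbit_Suc)
  have inv: "T x \<in> E \<longleftrightarrow> x \<in> E" if x: "x \<in> space M" for x
  proof
    assume Tx: "T x \<in> E"
    have "\<exists>n. S n x > real C" for C
    proof -
      obtain C' :: nat where "real C' \<ge> real C - f x" using real_arch_simple by blast
      moreover obtain n where "S n (T x) > real C'" using Tx by (auto simp: E_def)
      ultimately have "S (Suc n) x > real C" by (simp add: S_Suc)
      then show ?thesis ..
    qed
    with x show "x \<in> E" by (simp add: E_def)
  next
    assume xE: "x \<in> E"
    have "\<exists>n. S n (T x) > real C" for C
    proof -
      obtain C' :: nat where "real C' \<ge> real C + f x" using real_arch_simple by blast
      moreover obtain n where n: "S n x > real C'" using xE by (auto simp: E_def)
      moreover from n have "n \<noteq> 0" by (auto simp: S_def intro: ccontr)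
      then obtain k where "n = Suc k" using not0_implies_Suc by blast
      ultimately have "S k (T x) > real C" by (simp add: S_Suc)
      then show ?thesis ..
    qed
    with measure_preserving_in_space[OF T x] show "T x \<in> E" by (simp add: E_def)
  qed
  have "T -` E \<inter> space M = E"
    using inv by (auto simp: E_def)
  then consider "emeasure M E = 0" | "emeasure M (space M - E) = 0"
    using erg E by (auto simp: ergodic_def)
  then show ?thesis
  proof cases
    case 1
    then have "AE x in M. x \<notin> E" using E by (intro AE_not_in) auto
    with AE_space show ?thesis
      by eventually_elim (force simp: E_def S_def not_less)
  next
    case 2
    have "AE x in M. x \<notin> space M - E" using E 2 by (intro AE_not_in) auto
    then have AE_E: "AE x in M. x \<in> E" by (auto elim!: eventually_mono[rotated] intro: AE_I2)
    have m: "bounded_measurable M (?m n)" for n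
      by (rule bounded_measurable_max_partial_sum[OF T f])
    have mT: "bounded_measurable M (\<lambda>x. ?m n (T x))" for n
      by (rule bounded_measurable_compose[OF T m])
    note [measurable] = m[THEN bounded_measurable_measurable] mT[THEN bounded_measurable_measurable]
      f[THEN bounded_measurable_measurable]
    obtain B where B: "\<And>x. x \<in> space M \<Longrightarrow> norm (f x) \<le> B"
      using bounded_measurable_bound[OF f] by blast
    have "(\<lambda>n. \<integral>x. max (- ?m n (T x)) (f x) \<partial>M) \<longlonglongrightarrow> (\<integral>x. f x \<partial>M)"
    proof (rule integral_dominated_convergence[where w = "\<lambda>x. B"])
      show "AE x in M. (\<lambda>n. max (- ?m n (T x)) (f x)) \<longlonglongrightarrow> f x"
        using AE_E
      proof eventually_elim
        case (elim x)
        then have "T x \<in> E" using inv by (auto simp: E_def)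
        obtain C :: nat where "real C \<ge> - f x" using real_arch_simple by blast
        moreover obtain k where "S k (T x) > real C" using \<open>T x \<in> E\<close> by (auto simp: E_def)
        ultimately have k: "?m k (T x) \<ge> - f x"
          using sum_le_max_partial_sum[of f T "T x" k] by (simp add: S_def)
        have "?m n (T x) \<ge> - f x" if "n \<ge> k" for n
          using lift_Suc_mono_le[of "\<lambda>n. ?m n (T x)", OF max_partial_sum_mono that] k by simp
        then have "eventually (\<lambda>n. max (- ?m n (T x)) (f x) = f x) sequentially"
          by (intro eventually_sequentiallyI[of k]) (fastforce simp: max_def)
        then show ?case by (rule tendsto_eventually)
      qed
      show "AE x in M. norm (max (- ?m n (T x)) (f x)) \<le> B" for n
        using B max_partial_sum_nonneg[of f T n] by (intro AE_I2) (fastforce simp: max_def)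
    qed auto
    moreover have "(\<integral>x. max (- ?m n (T x)) (f x) \<partial>M) \<ge> 0" for n
    proof -
      have "(\<integral>x. ?m (Suc n) x \<partial>M) \<ge> (\<integral>x. ?m n x \<partial>M)"
        using max_partial_sum_mono by (intro integral_mono integrable_bounded_measurable m)
      also have "(\<integral>x. ?m n x \<partial>M) = (\<integral>x. ?m n (T x) \<partial>M)"
        by (rule measure_preserving_integral[OF T, symmetric]) simp
      finally have "0 \<le> (\<integral>x. ?m (Suc n) x \<partial>M) - (\<integral>x. ?m n (T x) \<partial>M)" by simp
      also have "\<dots> = (\<integral>x. ?m (Suc n) x - ?m n (T x) \<partial>M)"
        by (intro Bochner_Integration.integral_diff[symmetric] integrable_bounded_measurable m mT)
      also have "\<dots> = (\<integral>x. max (- ?m n (T x)) (f x) \<partial>M)"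
        by (intro Bochner_Integration.integral_cong) auto
      finally show ?thesis .
    qed
    ultimately have "(\<integral>x. f x \<partial>M) \<ge> 0" by (intro LIMSEQ_le_const) auto
    with neg show ?thesis by simp
  qed
qed

text \<open>For each \<open>\<epsilon> > 0\<close> the functions \<open>f - \<epsilon>\<close> and \<open>- f - \<epsilon>\<close> have negative integral, so that almost
  everywhere both \<open>S\<^sub>n - \<epsilon> n\<close> and \<open>- S\<^sub>n - \<epsilon> n\<close> are bounded above.\<close>

lemma (in prob_space) ergodic_averages_converge:
  fixes f :: "'a \<Rightarrow> real"
  assumes erg: "ergodic M T" and f: "bounded_measurable M f" and zero: "(\<integral>x. f x \<partial>M) = 0"
  shows "AE x in M. (\<lambda>n. (\<Sum>k<n. f ((T ^^ k) x)) / real n) \<longlonglongrightarrow> 0"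
proof -
  have above: "AE x in M. \<forall>i::nat. \<exists>C. \<forall>n. (\<Sum>k<n. g ((T ^^ k) x) - 1 / Suc i) \<le> C"
    if g: "bounded_measurable M g" and g0: "(\<integral>x. g x \<partial>M) = 0" for g :: "'a \<Rightarrow> real"
    unfolding AE_all_countable
  proof (intro allI ergodic_sums_bounded_above[OF erg])
    fix i :: nat
    show "bounded_measurable M (\<lambda>x. g x - 1 / Suc i)"
      by (intro bounded_measurable_diff bounded_measurable_const g)
    show "(\<integral>x. g x - 1 / Suc i \<partial>M) < 0"
      by (subst Bochner_Integration.integral_diff)
         (auto simp: g0 prob_space integrable_bounded_measurable[OF g])
  qed
  have f': "bounded_measurable M (\<lambda>x. 0 - f x)"
    by (intro bounded_measurable_diff bounded_measurable_const f)
  have "AE x in M. \<forall>i::nat. \<exists>C. \<forall>n. (\<Sum>k<n. f ((T ^^ k) x) - 1 / Suc i) \<le> C"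
    by (rule above[OF f zero])
  moreover have "AE x in M. \<forall>i::nat. \<exists>C. \<forall>n. (\<Sum>k<n. (0 - f ((T ^^ k) x)) - 1 / Suc i) \<le> C"
    by (rule above[OF f']) (simp add: zero)
  ultimately show ?thesis
  proof eventually_elim
    case (elim x)
    let ?S = "\<lambda>n. \<Sum>k<n. f ((T ^^ k) x)"
    show ?case
    proof (rule LIMSEQ_I)
      fix e :: real assume "e > 0"
      then obtain i :: nat where i: "1 / Suc i < e / 2"
        using nat_approx_posE[of "e/2"] by auto
      obtain C1 where C1: "\<And>n. ?S n - n / Suc i \<le> C1"
        using elim(1)[rule_format, of i] by (auto simp: sum_subtractf)
      obtain C2 where C2: "\<And>n. - ?S n - n / Suc i \<le> C2"
        using elim(2)[rule_format, of i] by (auto simp: sum_subtractf sum_negf)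
      define C where "C = max C1 C2"
      have C: "\<bar>?S n\<bar> \<le> C + n / Suc i" for n
        using C1[of n] C2[of n] unfolding C_def by (auto simp: abs_le_iff)
      obtain N :: nat where N: "real N > max 0 (2 * C / e)" using reals_Archimedean2 by blast
      have "norm (?S n / real n - 0) < e" if "n \<ge> N" for n
      proof -
        have n: "real n > 0" "real n > 2 * C / e" using N that by auto
        then have "C < real n * (e / 2)" using \<open>e > 0\<close> by (simp add: field_simps)
        moreover have "n / Suc i < real n * (e / 2)"
          using mult_strict_left_mono[OF i n(1)] by simp
        ultimately have "\<bar>?S n\<bar> < real n * (e / 2) + real n * (e / 2)" using C[of n] by linarith
        then have "\<bar>?S n\<bar> < real n * e" by (simp add: mult.commute flip: distrib_left)
        then show ?thesis using n by (simp add: field_simps)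
      qed
      then show "\<exists>N. \<forall>n\<ge>N. norm (?S n / real n - 0) < e" by blast
    qed
  qed
qed

lemma (in prob_space) mean_ergodic:
  fixes f :: "'a \<Rightarrow> complex"
  assumes erg: "ergodic M T" and f: "bounded_measurable M f" and zero: "(\<integral>x. f x \<partial>M) = 0"
  shows "(\<lambda>n. \<integral>x. (cmod ((\<Sum>k<n. f ((T ^^ k) x)) / of_nat n))\<^sup>2 \<partial>M) \<longlonglongrightarrow> 0"
proof -
  have T: "measure_preserving M T" using erg by (simp add: ergodic_def)
  obtain B where B: "B > 0" "\<And>x. x \<in> space M \<Longrightarrow> norm (f x) \<le> B"
    using bounded_measurable_bound[OF f] by blast
  note fT = bounded_measurable_compose[OF measure_preserving_funpow[OF T] f]
  note [measurable] = fT[THEN bounded_measurable_measurable]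
  have parts: "bounded_measurable M (\<lambda>x. Re (f x))" "bounded_measurable M (\<lambda>x. Im (f x))"
    using f[THEN bounded_measurable_measurable]
    by (auto intro!: bounded_measurableI[where B = B]
        intro: order_trans[OF abs_Re_le_cmod B(2)] order_trans[OF abs_Im_le_cmod B(2)])
  have "(\<integral>x. Re (f x) \<partial>M) = 0" "(\<integral>x. Im (f x) \<partial>M) = 0"
    using zero integrable_bounded_measurable[OF f] by (simp_all add: integral_Re integral_Im)
  note conv = ergodic_averages_converge[OF erg parts(1) this(1)]
    ergodic_averages_converge[OF erg parts(2) this(2)]
  have "(\<lambda>n. \<integral>x. (cmod ((\<Sum>k<n. f ((T ^^ k) x)) / of_nat n))\<^sup>2 \<partial>M) \<longlonglongrightarrow> (\<integral>x. 0 \<partial>M)"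
  proof (rule integral_dominated_convergence[where w = "\<lambda>x. B\<^sup>2"])
    show "AE x in M. (\<lambda>n. (cmod ((\<Sum>k<n. f ((T ^^ k) x)) / of_nat n))\<^sup>2) \<longlonglongrightarrow> 0"
      using conv
    proof eventually_elim
      case (elim x)
      have "(\<lambda>n. (\<Sum>k<n. f ((T ^^ k) x)) / of_nat n) \<longlonglongrightarrow> 0"
        unfolding tendsto_complex_iff using elim by simp
      from tendsto_power[OF tendsto_norm[OF this], of 2] show ?case by simp
    qed
    show "AE x in M. norm ((cmod ((\<Sum>k<n. f ((T ^^ k) x)) / of_nat n))\<^sup>2) \<le> B\<^sup>2" for n
    proof (intro AE_I2)
      fix x assume x: "x \<in> space M"
      have "cmod (\<Sum>k<n. f ((T ^^ k) x)) \<le> (\<Sum>k<n. B)"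
        by (intro sum_norm_le B measure_preserving_in_space[OF measure_preserving_funpow[OF T]] x)
      then have "cmod ((\<Sum>k<n. f ((T ^^ k) x)) / of_nat n) \<le> B"
        using B by (cases "n = 0") (auto simp: norm_divide field_simps)
      then show "norm ((cmod ((\<Sum>k<n. f ((T ^^ k) x)) / of_nat n))\<^sup>2) \<le> B\<^sup>2"
        by (simp add: power_mono)
    qed
  qed auto
  then show ?thesis by simp
qed

section \<open>Correlations along a weakly mixing map\<close>

text \<open>Squared norms of averages are averages of correlations over pairs of indices. The double sum is
  kept over all pairs \<open>h, k < H\<close> rather than indexed by \<open>h - k\<close>: it then has the same form for ergodic
  averages and for the windows of the van der Corput argument.\<close>

lemma (in prob_space) integral_cmod_mean_square:
  fixes v :: "nat \<Rightarrow> 'a \<Rightarrow> complex"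
  assumes v: "\<And>k. bounded_measurable M (v k)"
  shows "complex_of_real (\<integral>x. (cmod ((\<Sum>h<H. v h x) / of_nat H))\<^sup>2 \<partial>M) =
    (\<Sum>h<H. \<Sum>k<H. \<integral>x. v h x * cnj (v k x) \<partial>M) / (of_nat H)\<^sup>2"
proof -
  have int: "integrable M (\<lambda>x. v h x * cnj (v k x))" for h k
    by (intro integrable_bounded_measurable bounded_measurable_mult bounded_measurable_cnj v)
  have "complex_of_real (\<integral>x. (cmod ((\<Sum>h<H. v h x) / of_nat H))\<^sup>2 \<partial>M) =
      (\<integral>x. complex_of_real ((cmod ((\<Sum>h<H. v h x) / of_nat H))\<^sup>2) \<partial>M)"
    by (rule integral_complex_of_real[symmetric])
  also have "\<dots> = (\<integral>x. (\<Sum>h<H. \<Sum>k<H. v h x * cnj (v k x)) / (of_nat H)\<^sup>2 \<partial>M)"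
    by (intro Bochner_Integration.integral_cong refl)
       (simp only: complex_norm_square, simp add: sum_product power2_eq_square)
  also have "\<dots> = (\<Sum>h<H. \<Sum>k<H. \<integral>x. v h x * cnj (v k x) \<partial>M) / (of_nat H)\<^sup>2"
    using int by simp
  finally show ?thesis .
qed

lemma (in prob_space) integral_centred_correlation:
  fixes u v :: "'a \<Rightarrow> complex"
  assumes u: "bounded_measurable M u" and v: "bounded_measurable M v"
  shows "(\<integral>x. (u x - c) * cnj (v x - d) \<partial>M) =
    (\<integral>x. u x * cnj (v x) \<partial>M) - cnj d * (\<integral>x. u x \<partial>M) - c * cnj (\<integral>x. v x \<partial>M) + c * cnj d"
proof -
  have int: "integrable M u" "integrable M (\<lambda>x. cnj (v x))" "integrable M (\<lambda>x. u x * cnj (v x))"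
    by (intro integrable_bounded_measurable bounded_measurable_mult bounded_measurable_cnj u v)+
  have "(\<integral>x. (u x - c) * cnj (v x - d) \<partial>M) =
      (\<integral>x. u x * cnj (v x) - cnj d * u x - c * cnj (v x) + c * cnj d \<partial>M)"
    by (intro Bochner_Integration.integral_cong refl) (simp add: algebra_simps)
  also have "\<dots> = (\<integral>x. u x * cnj (v x) \<partial>M) - cnj d * (\<integral>x. u x \<partial>M)
      - c * (\<integral>x. cnj (v x) \<partial>M) + c * cnj d"
    using int by (simp add: prob_space)
  also have "(\<integral>x. cnj (v x) \<partial>M) = cnj (\<integral>x. v x \<partial>M)"
    by (rule Bochner_Integration.integral_cnj)
  finally show ?thesis .
qed

text \<open>The double average of the squared centred correlations is the squared norm of the ergodic
  average of \<open>g \<otimes> cnj g\<close> under \<open>R \<times> R\<close>, where \<open>g = f - \<integral> f\<close>; this function has integral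
  \<open>|\<integral> g|\<^sup>2 = 0\<close>, so the mean ergodic theorem on the product space applies.\<close>

lemma (in prob_space) weakly_mixing_correlations:
  fixes f :: "'a \<Rightarrow> complex"
  assumes wm: "weakly_mixing M R" and f: "bounded_measurable M f"
  shows "(\<lambda>H. (\<Sum>h<H. \<Sum>k<H. (cmod ((\<integral>x. f ((R ^^ h) x) * cnj (f ((R ^^ k) x)) \<partial>M)
      - (\<integral>x. f x \<partial>M) * cnj (\<integral>x. f x \<partial>M)))\<^sup>2) / (real H)\<^sup>2) \<longlonglongrightarrow> 0"
proof -
  interpret MM: pair_prob_space M M ..
  let ?MM = "M \<Otimes>\<^sub>M M" and ?Q = "map_prod R R"
  define m where "m = (\<integral>x. f x \<partial>M)"
  define g where "g x = f x - m" for x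
  define F where "F z = g (fst z) * cnj (g (snd z))" for z
  have R: "measure_preserving M R" and Q: "measure_preserving ?MM ?Q" and erg: "ergodic ?MM ?Q"
    using wm by (auto simp: weakly_mixing_def ergodic_def)
  have g: "bounded_measurable M g"
    unfolding g_def by (intro bounded_measurable_diff bounded_measurable_const f)
  have tensor: "bounded_measurable ?MM (\<lambda>z. u (fst z) * v (snd z))"
      and tensor_integral: "(\<integral>z. u (fst z) * v (snd z) \<partial>?MM) = (\<integral>x. u x \<partial>M) * (\<integral>x. v x \<partial>M)"
    if u: "bounded_measurable M u" and v: "bounded_measurable M v" for u v :: "'a \<Rightarrow> complex"
  proof -
    note [measurable] = u[THEN bounded_measurable_measurable] v[THEN bounded_measurable_measurable]
    obtain A where A: "\<And>x. x \<in> space M \<Longrightarrow> norm (u x) \<le> A"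
      using bounded_measurable_bound[OF u] by blast
    obtain B where B: "\<And>x. x \<in> space M \<Longrightarrow> norm (v x) \<le> B"
      using bounded_measurable_bound[OF v] by blast
    have "bounded_measurable ?MM (\<lambda>z. u (fst z))"
      by (rule bounded_measurableI[where B = A]) (auto simp: space_pair_measure A)
    moreover have "bounded_measurable ?MM (\<lambda>z. v (snd z))"
      by (rule bounded_measurableI[where B = B]) (auto simp: space_pair_measure B)
    ultimately show bm: "bounded_measurable ?MM (\<lambda>z. u (fst z) * v (snd z))"
      by (rule bounded_measurable_mult)
    have "(\<integral>z. u (fst z) * v (snd z) \<partial>?MM) = (\<integral>x. (\<integral>y. u x * v y \<partial>M) \<partial>M)"
      using MM.integral_fst'[OF MM.P.integrable_bounded_measurable[OF bm]] by simp
    then show "(\<integral>z. u (fst z) * v (snd z) \<partial>?MM) = (\<integral>x. u x \<partial>M) * (\<integral>x. v x \<partial>M)"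
      by simp
  qed
  have F: "bounded_measurable ?MM F"
    unfolding F_def by (intro tensor bounded_measurable_cnj g)
  have int_g: "(\<integral>x. g x \<partial>M) = 0"
    unfolding g_def by (subst Bochner_Integration.integral_diff)
       (auto simp: m_def prob_space integrable_bounded_measurable[OF f])
  have int_F: "(\<integral>z. F z \<partial>?MM) = 0"
    unfolding F_def by (subst tensor_integral) (auto simp: int_g intro: bounded_measurable_cnj g)
  have Q_pow: "(?Q ^^ h) z = ((R ^^ h) (fst z), (R ^^ h) (snd z))" for h z
    by (induction h) auto
  define a where "a h k = (\<integral>x. g ((R ^^ h) x) * cnj (g ((R ^^ k) x)) \<partial>M)" for h k
  have fR: "bounded_measurable M (\<lambda>x. f ((R ^^ h) x))" for h
    by (rule bounded_measurable_compose[OF measure_preserving_funpow[OF R] f])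
  have gR: "bounded_measurable M (\<lambda>x. g ((R ^^ h) x))" for h
    by (rule bounded_measurable_compose[OF measure_preserving_funpow[OF R] g])
  have int_fR: "(\<integral>x. f ((R ^^ h) x) \<partial>M) = m" for h
    unfolding m_def by (rule measure_preserving_integral[OF measure_preserving_funpow[OF R]
          bounded_measurable_measurable[OF f]])
  have a: "a h k = (\<integral>x. f ((R ^^ h) x) * cnj (f ((R ^^ k) x)) \<partial>M) - m * cnj m" for h k
    unfolding a_def g_def integral_centred_correlation[OF fR fR] int_fR by simp
  have corr: "(\<integral>z. F ((?Q ^^ h) z) * cnj (F ((?Q ^^ k) z)) \<partial>?MM) = of_real ((cmod (a h k))\<^sup>2)" for h k
  proof -
    have "(\<integral>z. F ((?Q ^^ h) z) * cnj (F ((?Q ^^ k) z)) \<partial>?MM) =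
        (\<integral>z. (g ((R ^^ h) (fst z)) * cnj (g ((R ^^ k) (fst z)))) *
          cnj (g ((R ^^ h) (snd z)) * cnj (g ((R ^^ k) (snd z)))) \<partial>?MM)"
      by (intro Bochner_Integration.integral_cong refl) (simp add: F_def Q_pow)
    also have "\<dots> = a h k * (\<integral>x. cnj (g ((R ^^ h) x) * cnj (g ((R ^^ k) x))) \<partial>M)"
      unfolding a_def
      by (rule tensor_integral) (intro bounded_measurable_mult bounded_measurable_cnj gR)+
    also have "(\<integral>x. cnj (g ((R ^^ h) x) * cnj (g ((R ^^ k) x))) \<partial>M) = cnj (a h k)"
      unfolding a_def by (rule Bochner_Integration.integral_cnj)
    finally show ?thesis by (simp only: complex_norm_square)
  qed
  have FQ: "bounded_measurable ?MM (\<lambda>z. F ((?Q ^^ h) z))" for h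
    by (rule bounded_measurable_compose[OF measure_preserving_funpow[OF Q] F])
  have "complex_of_real (\<integral>z. (cmod ((\<Sum>h<H. F ((?Q ^^ h) z)) / of_nat H))\<^sup>2 \<partial>?MM) =
      of_real ((\<Sum>h<H. \<Sum>k<H. (cmod (a h k))\<^sup>2) / (real H)\<^sup>2)" for H
    unfolding MM.P.integral_cmod_mean_square[OF FQ] corr by simp
  then have "(\<integral>z. (cmod ((\<Sum>h<H. F ((?Q ^^ h) z)) / of_nat H))\<^sup>2 \<partial>?MM) =
      (\<Sum>h<H. \<Sum>k<H. (cmod (a h k))\<^sup>2) / (real H)\<^sup>2" for H
    using of_real_eq_iff by blast
  with MM.P.mean_ergodic[OF erg F int_F] show ?thesis
    by (simp only: a m_def)
qed

text \<open>Strong Cesaro convergence in two indices. The absolute values are inside the average because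
  plain averages would not be compatible with products.\<close>

definition double_mean_limit :: "(nat \<Rightarrow> nat \<Rightarrow> complex) \<Rightarrow> complex \<Rightarrow> bool" where
  "double_mean_limit a L \<longleftrightarrow>
     (\<lambda>H. (\<Sum>h<H. \<Sum>k<H. cmod (a h k - L)) / (real H)\<^sup>2) \<longlonglongrightarrow> 0"

lemma double_mean_limitI_square:
  assumes "(\<lambda>H. (\<Sum>h<H. \<Sum>k<H. (cmod (a h k - L))\<^sup>2) / (real H)\<^sup>2) \<longlonglongrightarrow> 0"
  shows "double_mean_limit a L"
  unfolding double_mean_limit_def
proof (rule tendsto_sandwich[OF _ _ tendsto_const])
  let ?s = "\<lambda>H. sqrt ((\<Sum>h<H. \<Sum>k<H. (cmod (a h k - L))\<^sup>2) / (real H)\<^sup>2)"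
  (* Cauchy-Schwarz over the H^2 pairs of indices *)
  have "(\<Sum>h<H. \<Sum>k<H. cmod (a h k - L)) / (real H)\<^sup>2 \<le> ?s H" for H
  proof (cases "H = 0")
    case False
    have "(\<Sum>h<H. \<Sum>k<H. cmod (a h k - L))\<^sup>2
        = (\<Sum>(h,k)\<in>{..<H}\<times>{..<H}. cmod (a h k - L))\<^sup>2"
      by (simp add: sum.cartesian_product)
    also have "\<dots> \<le> (\<Sum>(h,k)\<in>{..<H}\<times>{..<H}. (cmod (a h k - L))\<^sup>2) * (real H)\<^sup>2"
      using sum_squared_le_sum_of_squares[of "\<lambda>(h,k). cmod (a h k - L)" "{..<H}\<times>{..<H}"]
      by (simp add: case_prod_unfold power2_eq_square)
    also have "(\<Sum>(h,k)\<in>{..<H}\<times>{..<H}. (cmod (a h k - L))\<^sup>2) =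
        (\<Sum>h<H. \<Sum>k<H. (cmod (a h k - L))\<^sup>2)"
      by (simp add: sum.cartesian_product)
    finally have "((\<Sum>h<H. \<Sum>k<H. cmod (a h k - L)) / (real H)\<^sup>2)\<^sup>2 \<le>
        (\<Sum>h<H. \<Sum>k<H. (cmod (a h k - L))\<^sup>2) / (real H)\<^sup>2"
      using False by (simp add: power_divide power2_eq_square field_simps)
    then show ?thesis by (rule real_le_rsqrt)
  qed simp
  then show "\<forall>\<^sub>F H in sequentially. (\<Sum>h<H. \<Sum>k<H. cmod (a h k - L)) / (real H)\<^sup>2 \<le> ?s H"
    by simp
  show "?s \<longlonglongrightarrow> 0" using tendsto_real_sqrt[OF assms] by simp
qed (auto intro!: always_eventually divide_nonneg_nonneg sum_nonneg)

lemma double_mean_limit_mult: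
  assumes a: "double_mean_limit a K" and b: "double_mean_limit b L"
    and B: "\<And>h k. cmod (a h k) \<le> B"
  shows "double_mean_limit (\<lambda>h k. a h k * b h k) (K * L)"
  unfolding double_mean_limit_def
proof (rule tendsto_sandwich[OF _ _ tendsto_const])
  let ?s = "\<lambda>c M H. (\<Sum>h<H. \<Sum>k<H. cmod (c h k - M)) / (real H)\<^sup>2"
  have "(\<lambda>H. B * ?s b L H + cmod L * ?s a K H) \<longlonglongrightarrow> B * 0 + cmod L * 0"
    using a b unfolding double_mean_limit_def by (intro tendsto_intros)
  then show "(\<lambda>H. B * ?s b L H + cmod L * ?s a K H) \<longlonglongrightarrow> 0" by simp
  have "cmod (a h k * b h k - K * L) \<le> B * cmod (b h k - L) + cmod L * cmod (a h k - K)" for h k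
  proof -
    have "a h k * b h k - K * L = a h k * (b h k - L) + L * (a h k - K)" by algebra
    then have "cmod (a h k * b h k - K * L) \<le> cmod (a h k) * cmod (b h k - L) + cmod L * cmod (a h k - K)"
      by (metis norm_mult norm_triangle_ineq)
    then show ?thesis using mult_right_mono[OF B[of h k] norm_ge_zero[of "b h k - L"]] by linarith
  qed
  then have "(\<Sum>h<H. \<Sum>k<H. cmod (a h k * b h k - K * L)) \<le>
      (\<Sum>h<H. \<Sum>k<H. B * cmod (b h k - L) + cmod L * cmod (a h k - K))" for H
    by (intro sum_mono)
  then have "?s (\<lambda>h k. a h k * b h k) (K * L) H \<le> B * ?s b L H + cmod L * ?s a K H" for H
    by (simp add: sum.distrib sum_distrib_left divide_right_mono flip: add_divide_distrib)
  then show "\<forall>\<^sub>F H in sequentially.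
      ?s (\<lambda>h k. a h k * b h k) (K * L) H \<le> B * ?s b L H + cmod L * ?s a K H" by simp
qed (auto intro!: always_eventually divide_nonneg_nonneg sum_nonneg)

lemma double_mean_limit_prod:
  assumes "finite J" "\<And>j. j \<in> J \<Longrightarrow> double_mean_limit (a j) (L j)"
    "\<And>j. j \<in> J \<Longrightarrow> \<exists>B. \<forall>h k. cmod (a j h k) \<le> B"
  shows "double_mean_limit (\<lambda>h k. \<Prod>j\<in>J. a j h k) (\<Prod>j\<in>J. L j)"
  using assms
proof (induction J rule: finite_induct)
  case empty
  then show ?case by (simp add: double_mean_limit_def)
next
  case (insert j J)
  obtain B where "\<And>h k. cmod (a j h k) \<le> B" using insert.prems(2)[of j] by auto
  then have "double_mean_limit (\<lambda>h k. a j h k * (\<Prod>j\<in>J. a j h k)) (L j * (\<Prod>j\<in>J. L j))"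
    using insert by (intro double_mean_limit_mult) auto
  then show ?case using insert.hyps by simp
qed

lemma double_mean_limitD:
  assumes "double_mean_limit a L"
  shows "(\<lambda>H. (\<Sum>h<H. \<Sum>k<H. a h k - L) / (of_nat H)\<^sup>2) \<longlonglongrightarrow> 0"
proof (rule Lim_null_comparison[OF _ assms[unfolded double_mean_limit_def]], rule always_eventually, rule allI)
  fix H
  have "cmod (\<Sum>h<H. \<Sum>k<H. a h k - L) \<le> (\<Sum>h<H. \<Sum>k<H. cmod (a h k - L))"
    by (intro sum_norm_le) auto
  then show "norm ((\<Sum>h<H. \<Sum>k<H. a h k - L) / (of_nat H)\<^sup>2) \<le>
      (\<Sum>h<H. \<Sum>k<H. cmod (a h k - L)) / (real H)\<^sup>2"
    by (simp add: norm_divide norm_power divide_right_mono)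
qed

section \<open>The van der Corput inequality\<close>

text \<open>Each shift by one changes the sum by two boundary terms.\<close>

lemma shifted_sum_close:
  fixes a :: "nat \<Rightarrow> complex"
  assumes "\<And>n. cmod (a n) \<le> B"
  shows "cmod ((\<Sum>n<N. a n) - (\<Sum>n<N. a (n + h))) \<le> 2 * real h * B"
proof (induction h)
  case (Suc h)
  have "(\<Sum>n<N. a (n + h)) + a (N + h) = (\<Sum>n<Suc N. a (n + h))" by simp
  also have "\<dots> = a h + (\<Sum>n<N. a (n + Suc h))"
    unfolding sum.lessThan_Suc_shift by simp
  finally have "(\<Sum>n<N. a n) - (\<Sum>n<N. a (n + Suc h)) =
      ((\<Sum>n<N. a n) - (\<Sum>n<N. a (n + h))) + (a h - a (N + h))" by (simp add: algebra_simps)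
  then have "cmod ((\<Sum>n<N. a n) - (\<Sum>n<N. a (n + Suc h))) \<le>
      cmod ((\<Sum>n<N. a n) - (\<Sum>n<N. a (n + h))) + cmod (a h - a (N + h))"
    by (metis norm_triangle_ineq)
  also have "\<dots> \<le> 2 * real h * B + (B + B)"
    by (intro add_mono Suc order_trans[OF norm_triangle_ineq4] assms)
  finally show ?case by (simp add: algebra_simps)
qed simp

text \<open>A sum is close to the sum of its window averages \<open>y\<^sub>n = (a\<^sub>n + \<dots> + a\<^sub>n\<^sub>+\<^sub>H\<^sub>-\<^sub>1) / H\<close>: it is an average
  of the \<open>H\<close> shifted sums up to a boundary error \<open>2 H B\<close>. The squared average of the \<open>y\<^sub>n\<close> is at most the
  average of their squares.\<close>

lemma window_mean_square_bound:
  fixes a :: "nat \<Rightarrow> complex"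
  assumes B: "\<And>n. cmod (a n) \<le> B" and "N > 0" "H > 0"
  shows "(cmod ((\<Sum>n<N. a n) / of_nat N))\<^sup>2 \<le>
    2 * ((\<Sum>n<N. (cmod ((\<Sum>h<H. a (n + h)) / of_nat H))\<^sup>2) / real N) + 2 * (2 * real H * B / real N)\<^sup>2"
proof -
  define y where "y n = (\<Sum>h<H. a (n + h)) / of_nat H" for n
  have "B \<ge> 0" using B[of 0] norm_ge_zero order_trans by blast
  have "of_nat H * ((\<Sum>n<N. a n) - (\<Sum>n<N. y n)) = (\<Sum>h<H. (\<Sum>n<N. a n) - (\<Sum>n<N. a (n + h)))"
  proof -
    have "of_nat H * (\<Sum>n<N. y n) = (\<Sum>n<N. \<Sum>h<H. a (n + h))"
      using \<open>H > 0\<close> unfolding sum_distrib_left by (intro sum.cong refl) (simp add: y_def)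
    also have "\<dots> = (\<Sum>h<H. \<Sum>n<N. a (n + h))" by (rule sum.swap)
    finally show ?thesis by (simp add: sum_subtractf algebra_simps)
  qed
  moreover have "cmod (\<Sum>h<H. (\<Sum>n<N. a n) - (\<Sum>n<N. a (n + h))) \<le> (\<Sum>h<H. 2 * real H * B)"
    using \<open>B \<ge> 0\<close>
    by (intro sum_norm_le order_trans[OF shifted_sum_close[OF B]] mult_right_mono) auto
  ultimately have "real H * cmod ((\<Sum>n<N. a n) - (\<Sum>n<N. y n)) \<le> real H * (2 * real H * B)"
    by (metis card_lessThan norm_mult norm_of_nat sum_constant)
  then have diff: "cmod ((\<Sum>n<N. a n) - (\<Sum>n<N. y n)) \<le> 2 * real H * B"
    using \<open>H > 0\<close> by simp
  have "cmod (\<Sum>n<N. a n) \<le> cmod (\<Sum>n<N. y n) + cmod ((\<Sum>n<N. a n) - (\<Sum>n<N. y n))"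
    by (metis add.commute norm_triangle_sub)
  also have "\<dots> \<le> (\<Sum>n<N. cmod (y n)) + 2 * real H * B"
    by (intro add_mono norm_sum diff)
  finally have "(cmod ((\<Sum>n<N. a n) / of_nat N))\<^sup>2 \<le>
      ((\<Sum>n<N. cmod (y n)) / real N + 2 * real H * B / real N)\<^sup>2"
    by (intro power_mono) (auto simp: norm_divide divide_right_mono simp flip: add_divide_distrib)
  also have "\<dots> \<le> 2 * ((\<Sum>n<N. cmod (y n)) / real N)\<^sup>2 + 2 * (2 * real H * B / real N)\<^sup>2"
    using sum_squares_bound[of "(\<Sum>n<N. cmod (y n)) / real N" "2 * real H * B / real N"]
    unfolding power2_sum by linarith
  also have "((\<Sum>n<N. cmod (y n)) / real N)\<^sup>2 \<le> (\<Sum>n<N. (cmod (y n))\<^sup>2) / real N"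
    using sum_squared_le_sum_of_squares[of "\<lambda>n. cmod (y n)" "{..<N}"] \<open>N > 0\<close>
    by (simp add: power_divide power2_eq_square field_simps)
  finally show ?thesis by (simp add: y_def)
qed

text \<open>The vectors being averaged may depend on the length \<open>N\<close> of the average. For a fixed window
  length \<open>H\<close>, letting \<open>N\<close> grow turns the window bound into twice the mean of \<open>\<gamma> h k\<close> over \<open>h, k < H\<close>, the
  boundary error being of order \<open>H / N\<close>; then \<open>H\<close> is chosen large.\<close>

lemma (in prob_space) van_der_Corput:
  fixes v :: "nat \<Rightarrow> nat \<Rightarrow> 'a \<Rightarrow> complex"
  assumes meas: "\<And>N n. v N n \<in> borel_measurable M"
    and B: "\<And>N n x. x \<in> space M \<Longrightarrow> cmod (v N n x) \<le> B"
    and corr: "\<And>h k. (\<lambda>N. (\<Sum>n<N. \<integral>x. v N (n + h) x * cnj (v N (n + k) x) \<partial>M) / of_nat N)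
      \<longlonglongrightarrow> \<gamma> h k"
    and mean: "(\<lambda>H. (\<Sum>h<H. \<Sum>k<H. \<gamma> h k) / (of_nat H)\<^sup>2) \<longlonglongrightarrow> 0"
  shows "(\<lambda>N. \<integral>x. (cmod ((\<Sum>n<N. v N n x) / of_nat N))\<^sup>2 \<partial>M) \<longlonglongrightarrow> 0"
proof -
  define D where "D N = (\<integral>x. (cmod ((\<Sum>n<N. v N n x) / of_nat N))\<^sup>2 \<partial>M)" for N
  define W where "W H N = (\<Sum>n<N. \<integral>x. (cmod ((\<Sum>h<H. v N (n + h) x) / of_nat H))\<^sup>2 \<partial>M) / real N" for H N
  define \<delta> where "\<delta> H = (\<Sum>h<H. \<Sum>k<H. \<gamma> h k) / (of_nat H)\<^sup>2" for H
  have bm: "bounded_measurable M (v N n)" for N n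
    using meas B by (rule bounded_measurableI)
  have bm_mean: "bounded_measurable M (\<lambda>x. (cmod ((\<Sum>h<K. v N (n + h) x) / of_nat K))\<^sup>2)" for N n K
  proof (rule bounded_measurable_cmod_square)
    have "bounded_measurable M (\<lambda>x. (\<Sum>h<K. v N (n + h) x) * (1 / of_nat K))"
      by (intro bounded_measurable_mult bounded_measurable_sum bounded_measurable_const bm)
    then show "bounded_measurable M (\<lambda>x. (\<Sum>h<K. v N (n + h) x) / of_nat K)" by simp
  qed
  have D_le: "D N \<le> 2 * W H N + 2 * (2 * real H * B / real N)\<^sup>2" if "N > 0" "H > 0" for N H
  proof -
    let ?g = "\<lambda>n x. (cmod ((\<Sum>h<H. v N (n + h) x) / of_nat H))\<^sup>2"
    have int: "integrable M (?g n)" for n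
      by (rule integrable_bounded_measurable[OF bm_mean])
    have "D N \<le> (\<integral>x. 2 * ((\<Sum>n<N. ?g n x) / real N) + 2 * (2 * real H * B / real N)\<^sup>2 \<partial>M)"
      unfolding D_def
    proof (rule integral_mono)
      show "integrable M (\<lambda>x. (cmod ((\<Sum>n<N. v N n x) / of_nat N))\<^sup>2)"
        using integrable_bounded_measurable[OF bm_mean[of N 0 N]] by simp
      show "integrable M (\<lambda>x. 2 * ((\<Sum>n<N. ?g n x) / real N) + 2 * (2 * real H * B / real N)\<^sup>2)"
        using int by simp
    qed (intro window_mean_square_bound B that)
    also have "\<dots> = 2 * W H N + 2 * (2 * real H * B / real N)\<^sup>2"
      using int by (simp add: W_def prob_space)
    finally show ?thesis .
  qed
  have W_lim: "(\<lambda>N. W H N) \<longlonglongrightarrow> Re (\<delta> H)" for H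
  proof -
    have "complex_of_real (W H N) =
        (\<Sum>h<H. \<Sum>k<H. (\<Sum>n<N. \<integral>x. v N (n + h) x * cnj (v N (n + k) x) \<partial>M) / of_nat N) / (of_nat H)\<^sup>2" for N
    proof -
      have "complex_of_real (W H N) = (\<Sum>n<N. complex_of_real
          (\<integral>x. (cmod ((\<Sum>h<H. v N (n + h) x) / of_nat H))\<^sup>2 \<partial>M)) / of_nat N"
        unfolding W_def by simp
      also have "\<dots> = (\<Sum>n<N. (\<Sum>h<H. \<Sum>k<H. \<integral>x. v N (n + h) x * cnj (v N (n + k) x) \<partial>M)
          / (of_nat H)\<^sup>2) / of_nat N"
        by (simp only: integral_cmod_mean_square[OF bm])
      also have "\<dots> = (\<Sum>n<N. \<Sum>h<H. \<Sum>k<H. \<integral>x. v N (n + h) x * cnj (v N (n + k) x) \<partial>M)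
          / of_nat N / (of_nat H)\<^sup>2"
        by (simp flip: sum_divide_distrib)
      also have "(\<Sum>n<N. \<Sum>h<H. \<Sum>k<H. \<integral>x. v N (n + h) x * cnj (v N (n + k) x) \<partial>M) =
          (\<Sum>h<H. \<Sum>k<H. \<Sum>n<N. \<integral>x. v N (n + h) x * cnj (v N (n + k) x) \<partial>M)"
        by (rule trans[OF sum.swap]) (intro sum.cong refl sum.swap)
      finally show ?thesis by (simp only: sum_divide_distrib)
    qed
    moreover have "(\<lambda>N. (\<Sum>h<H. \<Sum>k<H. (\<Sum>n<N. \<integral>x. v N (n + h) x * cnj (v N (n + k) x) \<partial>M)
        / of_nat N) / (of_nat H)\<^sup>2) \<longlonglongrightarrow> \<delta> H"
      unfolding \<delta>_def by (cases "H = 0") (auto intro!: tendsto_intros corr)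
    ultimately have "(\<lambda>N. complex_of_real (W H N)) \<longlonglongrightarrow> \<delta> H" by simp
    from tendsto_Re[OF this] show ?thesis by simp
  qed
  have "D \<longlonglongrightarrow> 0"
  proof (rule LIMSEQ_I)
    fix e :: real assume "e > 0"
    have "(\<lambda>H. Re (\<delta> H)) \<longlonglongrightarrow> Re 0" unfolding \<delta>_def by (rule tendsto_Re[OF mean])
    then have "eventually (\<lambda>H. Re (\<delta> H) < e / 2) sequentially"
      using \<open>e > 0\<close> by (intro order_tendstoD(2)[where y = 0]) auto
    then obtain H where H: "H > 0" "Re (\<delta> H) < e / 2"
      using eventually_gt_at_top[of "0::nat"] eventually_happens'[OF sequentially_bot]
      by (metis (mono_tags, lifting) eventually_conj)
    have "(\<lambda>N. 2 * W H N + 2 * (2 * real H * B / real N)\<^sup>2) \<longlonglongrightarrow> 2 * Re (\<delta> H) + 2 * 0\<^sup>2"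
      by (intro tendsto_intros W_lim lim_const_over_n)
    then have "eventually (\<lambda>N. 2 * W H N + 2 * (2 * real H * B / real N)\<^sup>2 < e) sequentially"
      by (rule order_tendstoD(2)) (use H in simp)
    then have "eventually (\<lambda>N. norm (D N - 0) < e) sequentially"
      using eventually_gt_at_top[of "0::nat"]
    proof eventually_elim
      case (elim N)
      have "D N \<ge> 0" unfolding D_def by (intro Bochner_Integration.integral_nonneg) auto
      with D_le[OF elim(2) H(1)] elim(1) show ?case by simp
    qed
    then show "\<exists>N0. \<forall>N\<ge>N0. norm (D N - 0) < e" by (simp only: eventually_sequentially)
  qed
  then show ?thesis unfolding D_def .
qed

section \<open>Joint mixing of two-parameter families of maps\<close>

text \<open>The maps \<open>P j N n\<close> play the role of \<open>T\<^sub>j\<^sup>n S\<^sub>j\<^sup>N\<close>, \<open>Q j N n\<close> that of its inverse, and \<open>R i j\<close> that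
  of \<open>T\<^sub>j T\<^sub>i\<^sup>-\<^sup>1\<close>. The last assumption expresses that all these maps commute. Since the
  same maps serve at every stage, only the index set varies in the induction.\<close>

locale mixing_family = prob_space M for M :: "'a measure" +
  fixes I :: "'i set" and P Q :: "'i \<Rightarrow> nat \<Rightarrow> nat \<Rightarrow> 'a \<Rightarrow> 'a" and R :: "'i \<Rightarrow> 'i \<Rightarrow> 'a \<Rightarrow> 'a"
  assumes P: "j \<in> I \<Longrightarrow> measure_preserving M (P j N n)"
    and Q: "j \<in> I \<Longrightarrow> measure_preserving M (Q j N n)"
    and P_Q: "j \<in> I \<Longrightarrow> x \<in> space M \<Longrightarrow> P j N n (Q j N n x) = x"
    and R: "i \<in> I \<Longrightarrow> j \<in> I \<Longrightarrow> i \<noteq> j \<Longrightarrow> weakly_mixing M (R i j)"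
    and P_Q_Suc: "i \<in> I \<Longrightarrow> j \<in> I \<Longrightarrow> i \<noteq> j \<Longrightarrow> x \<in> space M \<Longrightarrow>
      P j N (Suc n) (Q i N (Suc n) x) = R i j (P j N n (Q i N n x))"
begin

definition jointly_mixing :: "'i set \<Rightarrow> bool" where
  "jointly_mixing J \<longleftrightarrow> (\<forall>f :: 'i \<Rightarrow> 'a \<Rightarrow> complex. (\<forall>j\<in>J. bounded_measurable M (f j)) \<longrightarrow>
     (\<lambda>N. (\<Sum>n<N. \<integral>x. (\<Prod>j\<in>J. f j (P j N n x)) \<partial>M) / of_nat N) \<longlonglongrightarrow> (\<Prod>j\<in>J. \<integral>x. f j x \<partial>M))"

lemma jointly_mixingD:
  fixes f :: "'i \<Rightarrow> 'a \<Rightarrow> complex"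
  assumes "jointly_mixing J" "\<And>j. j \<in> J \<Longrightarrow> bounded_measurable M (f j)"
  shows "(\<lambda>N. (\<Sum>n<N. \<integral>x. (\<Prod>j\<in>J. f j (P j N n x)) \<partial>M) / of_nat N) \<longlonglongrightarrow> (\<Prod>j\<in>J. \<integral>x. f j x \<partial>M)"
  using assms unfolding jointly_mixing_def by blast

lemma P_Q_add:
  assumes "i \<in> I" "j \<in> I" "i \<noteq> j" "x \<in> space M"
  shows "P j N (n + h) (Q i N (n + h) x) = (R i j ^^ h) (P j N n (Q i N n x))"
  by (induction h) (simp_all add: P_Q_Suc[OF assms])

text \<open>Joint mixing over \<open>J\<close> gives the limits of both the means and the correlations of
  \<open>w\<^sub>n = \<Prod>\<^sub>j f\<^sub>j \<circ> P\<^sub>j Q\<^sub>i\<close>, since \<open>Q\<^sub>i\<close> disappears under the integral and a shift of \<open>n\<close> amounts to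
  composing the \<open>f\<^sub>j\<close> with powers of \<open>R\<^sub>i\<^sub>j\<close>. Centring \<open>w\<^sub>n\<close> at \<open>c\<close> subtracts \<open>|c|\<^sup>2\<close> from the limits of the
  correlations, which is the value that these approach in mean by weak mixing.\<close>

lemma jointly_mixing_imp_L2:
  fixes f :: "'i \<Rightarrow> 'a \<Rightarrow> complex"
  assumes J: "finite J" "J \<subseteq> I" and i: "i \<in> I" "i \<notin> J" and mix: "jointly_mixing J"
    and f: "\<And>j. j \<in> J \<Longrightarrow> bounded_measurable M (f j)"
  shows "(\<lambda>N. \<integral>x. (cmod ((\<Sum>n<N. \<Prod>j\<in>J. f j (P j N n (Q i N n x))) / of_nat N
      - (\<Prod>j\<in>J. \<integral>y. f j y \<partial>M)))\<^sup>2 \<partial>M) \<longlonglongrightarrow> 0"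
proof -
  define c where "c = (\<Prod>j\<in>J. \<integral>y. f j y \<partial>M)"
  define w where "w N n x = (\<Prod>j\<in>J. f j (P j N n (Q i N n x)))" for N n x
  define a where "a j h k = (\<integral>x. f j ((R i j ^^ h) x) * cnj (f j ((R i j ^^ k) x)) \<partial>M)" for j h k
  define \<gamma> where "\<gamma> h k = (\<Prod>j\<in>J. a j h k) - c * cnj c" for h k
  have R_pow: "measure_preserving M (\<lambda>x. (R i j ^^ h) x)" if "j \<in> J" for j h
  proof -
    have "weakly_mixing M (R i j)" using R i that J(2) by blast
    then show ?thesis by (intro measure_preserving_funpow) (simp add: weakly_mixing_def)
  qed
  have fR: "bounded_measurable M (\<lambda>x. f j ((R i j ^^ h) x))" if "j \<in> J" for j h
    by (rule bounded_measurable_compose[OF R_pow[OF that] f[OF that]])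
  have PQ: "measure_preserving M (\<lambda>x. P j N n (Q i N n x))" if "j \<in> J" for j N n
    by (rule measure_preserving_comp[OF P Q]) (use i that J(2) in auto)
  have w: "bounded_measurable M (w N n)" for N n
    unfolding w_def by (rule bounded_measurable_prod) (rule bounded_measurable_compose[OF PQ f])
  have "\<forall>j\<in>J. \<exists>B. \<forall>x\<in>space M. cmod (f j x) \<le> B"
    using f unfolding bounded_measurable_def by blast
  then obtain b where b: "\<And>j x. j \<in> J \<Longrightarrow> x \<in> space M \<Longrightarrow> cmod (f j x) \<le> b j" by metis
  have w_bound: "cmod (w N n x) \<le> (\<Prod>j\<in>J. b j)" if "x \<in> space M" for N n x
    unfolding w_def prod_norm[symmetric]
    using that by (intro prod_mono conjI norm_ge_zero b measure_preserving_in_space[OF PQ])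
  have w_add: "w N (n + h) x = (\<Prod>j\<in>J. f j ((R i j ^^ h) (P j N n (Q i N n x))))"
    if "x \<in> space M" for N n h x
    unfolding w_def using i J(2) that by (intro prod.cong refl) (subst P_Q_add, auto)
  have to_P: "(\<integral>x. (\<Prod>j\<in>J. g j (P j N n (Q i N n x))) \<partial>M) = (\<integral>x. (\<Prod>j\<in>J. g j (P j N n x)) \<partial>M)"
    if "\<And>j. j \<in> J \<Longrightarrow> bounded_measurable M (g j)" for g :: "'i \<Rightarrow> 'a \<Rightarrow> complex" and N n
    using J(2) by (intro measure_preserving_integral[where f = "\<lambda>x. \<Prod>j\<in>J. g j (P j N n x)"] Q i
        bounded_measurable_measurable bounded_measurable_prod bounded_measurable_compose[OF P] that) auto
  have mean_lim: "(\<lambda>N. (\<Sum>n<N. \<integral>x. w N (n + h) x \<partial>M) / of_nat N) \<longlonglongrightarrow> c" for h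
  proof -
    have "(\<integral>x. w N (n + h) x \<partial>M) = (\<integral>x. (\<Prod>j\<in>J. f j ((R i j ^^ h) (P j N n x))) \<partial>M)" for N n
      using to_P[of "\<lambda>j x. f j ((R i j ^^ h) x)", OF fR]
      by (simp add: w_add cong: Bochner_Integration.integral_cong)
    moreover have "(\<Prod>j\<in>J. \<integral>x. f j ((R i j ^^ h) x) \<partial>M) = c"
      unfolding c_def
      by (intro prod.cong refl measure_preserving_integral R_pow bounded_measurable_measurable f)
    ultimately show ?thesis
      using jointly_mixingD[OF mix, of "\<lambda>j x. f j ((R i j ^^ h) x)", OF fR] by simp
  qed
  have corr_lim: "(\<lambda>N. (\<Sum>n<N. \<integral>x. w N (n + h) x * cnj (w N (n + k) x) \<partial>M) / of_nat N)
      \<longlonglongrightarrow> (\<Prod>j\<in>J. a j h k)" for h k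
  proof -
    let ?g = "\<lambda>j x. f j ((R i j ^^ h) x) * cnj (f j ((R i j ^^ k) x))"
    have g: "bounded_measurable M (?g j)" if "j \<in> J" for j
      by (intro bounded_measurable_mult bounded_measurable_cnj fR that)
    have "(\<integral>x. w N (n + h) x * cnj (w N (n + k) x) \<partial>M) = (\<integral>x. (\<Prod>j\<in>J. ?g j (P j N n x)) \<partial>M)" for N n
      using to_P[of ?g, OF g]
      by (simp add: w_add prod.distrib cong: Bochner_Integration.integral_cong)
    then show ?thesis
      using jointly_mixingD[OF mix, of ?g, OF g] by (simp add: a_def)
  qed
  have "(\<lambda>N. \<integral>x. (cmod ((\<Sum>n<N. w N n x - c) / of_nat N))\<^sup>2 \<partial>M) \<longlonglongrightarrow> 0"
  proof (rule van_der_Corput)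
    show "(\<lambda>x. w N n x - c) \<in> borel_measurable M" for N n
      by (intro bounded_measurable_measurable bounded_measurable_diff bounded_measurable_const w)
    show "cmod (w N n x - c) \<le> (\<Prod>j\<in>J. b j) + cmod c" if "x \<in> space M" for N n x
      using w_bound[OF that, of N n] norm_triangle_ineq4[of "w N n x" c] by linarith
    fix h k
    have "(\<lambda>N. (\<Sum>n<N. \<integral>x. w N (n + h) x * cnj (w N (n + k) x) \<partial>M) / of_nat N
        - cnj c * ((\<Sum>n<N. \<integral>x. w N (n + h) x \<partial>M) / of_nat N)
        - c * cnj ((\<Sum>n<N. \<integral>x. w N (n + k) x \<partial>M) / of_nat N) + c * cnj c)
      \<longlonglongrightarrow> (\<Prod>j\<in>J. a j h k) - cnj c * c - c * cnj c + c * cnj c"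
      by (intro tendsto_intros corr_lim mean_lim)
    moreover have "eventually (\<lambda>N.
        (\<Sum>n<N. \<integral>x. w N (n + h) x * cnj (w N (n + k) x) \<partial>M) / of_nat N
        - cnj c * ((\<Sum>n<N. \<integral>x. w N (n + h) x \<partial>M) / of_nat N)
        - c * cnj ((\<Sum>n<N. \<integral>x. w N (n + k) x \<partial>M) / of_nat N) + c * cnj c
        = (\<Sum>n<N. \<integral>x. (w N (n + h) x - c) * cnj (w N (n + k) x - c) \<partial>M) / of_nat N) sequentially"
      using eventually_gt_at_top[of "0::nat"]
    proof eventually_elim
      case (elim N)
      then show ?case
        unfolding integral_centred_correlation[OF w w]
        by (simp add: sum.distrib sum_subtractf diff_divide_distrib add_divide_distrib
            flip: sum_distrib_left)
    qed
    ultimately show "(\<lambda>N. (\<Sum>n<N. \<integral>x. (w N (n + h) x - c) * cnj (w N (n + k) x - c) \<partial>M) / of_nat N)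
        \<longlonglongrightarrow> \<gamma> h k"
      unfolding \<gamma>_def by (auto dest: Lim_transform_eventually simp: mult.commute)
  next
    have "double_mean_limit (\<lambda>h k. \<Prod>j\<in>J. a j h k)
        (\<Prod>j\<in>J. (\<integral>x. f j x \<partial>M) * cnj (\<integral>x. f j x \<partial>M))"
    proof (rule double_mean_limit_prod[OF J(1)])
      fix j assume j: "j \<in> J"
      have "weakly_mixing M (R i j)" using R i j J(2) by blast
      then show "double_mean_limit (a j) ((\<integral>x. f j x \<partial>M) * cnj (\<integral>x. f j x \<partial>M))"
        unfolding a_def by (intro double_mean_limitI_square weakly_mixing_correlations f j)
      have "b j \<ge> 0" using b[OF j] not_empty norm_ge_zero order_trans by blast
      have "cmod (a j h k) \<le> b j * b j" for h k
        unfolding a_def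
      proof (rule bounded_measurable_integral_bound)
        show "bounded_measurable M (\<lambda>x. f j ((R i j ^^ h) x) * cnj (f j ((R i j ^^ k) x)))"
          by (intro bounded_measurable_mult bounded_measurable_cnj fR j)
        show "cmod (f j ((R i j ^^ h) x) * cnj (f j ((R i j ^^ k) x))) \<le> b j * b j"
          if x: "x \<in> space M" for x
          unfolding norm_mult complex_mod_cnj
          using \<open>b j \<ge> 0\<close>
          by (intro mult_mono b[OF j] measure_preserving_in_space[OF R_pow[OF j] x]) auto
      qed
      then show "\<exists>B. \<forall>h k. cmod (a j h k) \<le> B" by blast
    qed
    then show "(\<lambda>H. (\<Sum>h<H. \<Sum>k<H. \<gamma> h k) / (of_nat H)\<^sup>2) \<longlonglongrightarrow> 0"
      unfolding \<gamma>_def by (intro double_mean_limitD) (simp add: c_def prod.distrib)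
  qed
  moreover have "eventually (\<lambda>N. (\<integral>x. (cmod ((\<Sum>n<N. w N n x - c) / of_nat N))\<^sup>2 \<partial>M) =
      (\<integral>x. (cmod ((\<Sum>n<N. w N n x) / of_nat N - c))\<^sup>2 \<partial>M)) sequentially"
    using eventually_gt_at_top[of "0::nat"]
    by eventually_elim (simp add: sum_subtractf diff_divide_distrib)
  ultimately show ?thesis
    unfolding w_def c_def by (rule Lim_transform_eventually)
qed

text \<open>Changing variables by \<open>Q i N n\<close> frees the factor \<open>f\<^sub>i\<close> of its dependence on \<open>n\<close>, so the average can
  be taken under the integral and the \<open>L\<^sup>2\<close> convergence applies.\<close>

lemma jointly_mixing_insert:
  assumes J: "finite J" "J \<subseteq> I" and i: "i \<in> I" "i \<notin> J" and mix: "jointly_mixing J"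
  shows "jointly_mixing (insert i J)"
  unfolding jointly_mixing_def
proof (intro allI impI)
  fix f :: "'i \<Rightarrow> 'a \<Rightarrow> complex" assume "\<forall>j\<in>insert i J. bounded_measurable M (f j)"
  then have fi: "bounded_measurable M (f i)" and f: "\<And>j. j \<in> J \<Longrightarrow> bounded_measurable M (f j)"
    by auto
  define c where "c = (\<Prod>j\<in>J. \<integral>y. f j y \<partial>M)"
  define A where "A N x = (\<Sum>n<N. \<Prod>j\<in>J. f j (P j N n (Q i N n x))) / of_nat N" for N x
  have w: "bounded_measurable M (\<lambda>x. \<Prod>j\<in>J. f j (P j N n (Q i N n x)))" for N n
  proof (rule bounded_measurable_prod)
    fix j assume j: "j \<in> J"
    have "measure_preserving M (\<lambda>x. P j N n (Q i N n x))"
      by (rule measure_preserving_comp[OF P Q]) (use i j J(2) in auto)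
    then show "bounded_measurable M (\<lambda>x. f j (P j N n (Q i N n x)))"
      by (rule bounded_measurable_compose[OF _ f[OF j]])
  qed
  have "bounded_measurable M (\<lambda>x. (\<Sum>n<N. \<Prod>j\<in>J. f j (P j N n (Q i N n x))) * (1 / of_nat N))" for N
    by (intro bounded_measurable_mult bounded_measurable_sum bounded_measurable_const w)
  then have A: "bounded_measurable M (A N)" for N by (simp add: A_def[abs_def])
  have Ac: "bounded_measurable M (\<lambda>x. A N x - c)" for N
    by (intro bounded_measurable_diff bounded_measurable_const A)
  have Ac_norm: "bounded_measurable M (\<lambda>x. cmod (A N x - c))" for N
    using Ac[of N] by (auto simp: bounded_measurable_def)
  obtain B where B: "B > 0" "\<And>x. x \<in> space M \<Longrightarrow> cmod (f i x) \<le> B"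
    using bounded_measurable_bound[OF fi] by blast
  have shift: "(\<integral>x. (\<Prod>j\<in>insert i J. f j (P j N n x)) \<partial>M) =
      (\<integral>x. f i x * (\<Prod>j\<in>J. f j (P j N n (Q i N n x))) \<partial>M)" for N n
  proof -
    have "(\<integral>x. (\<Prod>j\<in>insert i J. f j (P j N n x)) \<partial>M) =
        (\<integral>x. (\<Prod>j\<in>insert i J. f j (P j N n (Q i N n x))) \<partial>M)"
      using J(2) i fi f
      by (intro measure_preserving_integral[where f = "\<lambda>x. \<Prod>j\<in>insert i J. f j (P j N n x)", symmetric]
          Q bounded_measurable_measurable bounded_measurable_prod bounded_measurable_compose[OF P]) auto
    also have "\<dots> = (\<integral>x. f i x * (\<Prod>j\<in>J. f j (P j N n (Q i N n x))) \<partial>M)"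
      using J(1) i by (intro Bochner_Integration.integral_cong refl) (simp add: P_Q)
    finally show ?thesis .
  qed
  have int_prod: "integrable M (\<lambda>x. f i x * (\<Prod>j\<in>J. f j (P j N n (Q i N n x))))" for N n
    by (intro integrable_bounded_measurable bounded_measurable_mult fi w)
  have eq: "(\<Sum>n<N. \<integral>x. (\<Prod>j\<in>insert i J. f j (P j N n x)) \<partial>M) / of_nat N - (\<integral>x. f i x \<partial>M) * c =
      (\<integral>x. f i x * (A N x - c) \<partial>M)" for N
  proof -
    have "(\<Sum>n<N. \<integral>x. (\<Prod>j\<in>insert i J. f j (P j N n x)) \<partial>M) / of_nat N =
        (\<integral>x. f i x * A N x \<partial>M)"
      unfolding shift A_def using int_prod by (simp add: sum_distrib_left)
    moreover have "(\<integral>x. f i x * (A N x - c) \<partial>M) = (\<integral>x. f i x * A N x - f i x * c \<partial>M)"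
      by (simp add: right_diff_distrib)
    moreover have "\<dots> = (\<integral>x. f i x * A N x \<partial>M) - (\<integral>x. f i x * c \<partial>M)"
      by (intro Bochner_Integration.integral_diff integrable_bounded_measurable
          bounded_measurable_mult bounded_measurable_const fi A)
    ultimately show ?thesis by simp
  qed
  have bound: "norm ((\<Sum>n<N. \<integral>x. (\<Prod>j\<in>insert i J. f j (P j N n x)) \<partial>M) / of_nat N - (\<integral>x. f i x \<partial>M) * c)
      \<le> B * sqrt (\<integral>x. (cmod (A N x - c))\<^sup>2 \<partial>M)" for N
  proof -
    have int: "integrable M (\<lambda>x. cmod (A N x - c))" "integrable M (\<lambda>x. (cmod (A N x - c))\<^sup>2)"
      by (intro integrable_bounded_measurable Ac_norm bounded_measurable_cmod_square Ac)+
    have "cmod (\<integral>x. f i x * (A N x - c) \<partial>M) \<le> (\<integral>x. cmod (f i x * (A N x - c)) \<partial>M)" by simp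
    also have "\<dots> \<le> (\<integral>x. B * cmod (A N x - c) \<partial>M)"
    proof (rule integral_mono)
      show "integrable M (\<lambda>x. cmod (f i x * (A N x - c)))"
        by (intro integrable_norm integrable_bounded_measurable bounded_measurable_mult fi Ac)
    qed (use int B in \<open>auto simp: norm_mult mult_right_mono\<close>)
    also have "\<dots> = B * (\<integral>x. cmod (A N x - c) \<partial>M)" by simp
    also have "(\<integral>x. cmod (A N x - c) \<partial>M) \<le> sqrt (\<integral>x. (cmod (A N x - c))\<^sup>2 \<partial>M)"
      (* nonnegativity of the variance serves as the Cauchy-Schwarz inequality against 1 *)
      using variance_positive[of "\<lambda>x. cmod (A N x - c)"] variance_eq[OF int]
      by (intro real_le_rsqrt) simp
    finally show ?thesis using B(1) by (simp add: eq)
  qed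
  have "(\<lambda>N. \<integral>x. (cmod (A N x - c))\<^sup>2 \<partial>M) \<longlonglongrightarrow> 0"
    unfolding A_def c_def by (rule jointly_mixing_imp_L2[OF J i mix f])
  from tendsto_mult_left[OF tendsto_real_sqrt[OF this], of B]
  have "(\<lambda>N. B * sqrt (\<integral>x. (cmod (A N x - c))\<^sup>2 \<partial>M)) \<longlonglongrightarrow> 0" by simp
  then have "(\<lambda>N. (\<Sum>n<N. \<integral>x. (\<Prod>j\<in>insert i J. f j (P j N n x)) \<partial>M) / of_nat N
      - (\<integral>x. f i x \<partial>M) * c) \<longlonglongrightarrow> 0"
    by (rule Lim_null_comparison[OF always_eventually[OF allI[OF bound]]])
  then show "(\<lambda>N. (\<Sum>n<N. \<integral>x. (\<Prod>j\<in>insert i J. f j (P j N n x)) \<partial>M) / of_nat N)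
      \<longlonglongrightarrow> (\<Prod>j\<in>insert i J. \<integral>x. f j x \<partial>M)"
    using J(1) i(2) by (simp add: c_def LIM_zero_iff)
qed

lemma jointly_mixing_finite:
  assumes "finite J" "J \<subseteq> I"
  shows "jointly_mixing J"
  using assms
proof (induction J rule: finite_induct)
  case empty
  have "(\<lambda>N. of_nat N / of_nat N :: complex) \<longlonglongrightarrow> 1"
    using eventually_gt_at_top[of "0::nat"] by (intro tendsto_eventually) (auto elim: eventually_mono)
  then show ?case by (simp add: jointly_mixing_def prob_space)
next
  case (insert j J)
  then show ?case by (intro jointly_mixing_insert) auto
qed

lemma L2_convergence:
  fixes f :: "'i \<Rightarrow> 'a \<Rightarrow> complex"
  assumes "finite J" "J \<subseteq> I" "i \<in> I" "i \<notin> J" "\<And>j. j \<in> J \<Longrightarrow> bounded_measurable M (f j)"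
  shows "(\<lambda>N. \<integral>x. (cmod ((\<Sum>n<N. \<Prod>j\<in>J. f j (P j N n (Q i N n x))) / of_nat N
      - (\<Prod>j\<in>J. \<integral>y. f j y \<partial>M)))\<^sup>2 \<partial>M) \<longlonglongrightarrow> 0"
  by (rule jointly_mixing_imp_L2[OF assms(1-4) jointly_mixing_finite[OF assms(1,2)] assms(5)])

end

section \<open>Mixing actions of abelian groups\<close>

lemma funpow_in: "(\<And>x. x \<in> X \<Longrightarrow> T x \<in> X) \<Longrightarrow> x \<in> X \<Longrightarrow> (T ^^ n) x \<in> X"
  by (induction n) auto

lemma commute_on_sym: "commute_on X S T \<Longrightarrow> commute_on X T S"
  by (simp add: commute_on_def)

lemma commute_on_funpow:
  assumes "commute_on X S T" "\<And>x. x \<in> X \<Longrightarrow> T x \<in> X"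
  shows "commute_on X S (T ^^ n)"
proof (induction n)
  case (Suc n)
  then show ?case using assms(1) funpow_in[OF assms(2)] by (simp add: commute_on_def)
qed (simp add: commute_on_def)

lemma funpow_cong_on:
  assumes "\<And>x. x \<in> X \<Longrightarrow> S x = T x" "\<And>x. x \<in> X \<Longrightarrow> T x \<in> X" "x \<in> X"
  shows "(S ^^ n) x = (T ^^ n) x"
  by (induction n) (simp_all add: assms(1) funpow_in[OF assms(2,3)])

lemma funpow_comp_on:
  assumes "commute_on X S T" "\<And>x. x \<in> X \<Longrightarrow> S x \<in> X" "\<And>x. x \<in> X \<Longrightarrow> T x \<in> X" "x \<in> X"
  shows "(S ^^ n) ((T ^^ n) x) = ((\<lambda>x. S (T x)) ^^ n) x"
proof (induction n)
  case (Suc n)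
  have "(S ^^ n) (T ((T ^^ n) x)) = T ((S ^^ n) ((T ^^ n) x))"
    using commute_on_funpow[OF commute_on_sym[OF assms(1)] assms(2)] funpow_in[OF assms(3,4)]
    by (simp add: commute_on_def)
  with Suc show ?case by simp
qed simp

theorem theorem2p4:
  fixes M :: "'a measure"
    and G :: "('g, 'm) monoid_scheme"
    and \<phi> :: "'g \<Rightarrow> 'a \<Rightarrow> 'a"
    and l :: nat
    and t :: "nat \<Rightarrow> 'g"
    and That :: "nat \<Rightarrow> 'a \<Rightarrow> 'a"
    and f :: "nat \<Rightarrow> 'a \<Rightarrow> complex"
  assumes "prob_space M" and "separable_measure M"
    and "free_abelian G" and "finitely_generated G"
    and "measure_preserving_action G M \<phi>" and "totally_weak_mixing G M \<phi>"
    and "l \<ge> 1"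
    and "\<And>j. j \<in> {1..l} \<Longrightarrow> t j \<in> carrier G \<and> t j \<noteq> \<one>\<^bsub>G\<^esub>"
    and "inj_on t {1..l}"
    and "\<And>j. j \<in> {1..l} \<Longrightarrow> invertible_measure_preserving M (That j)"
    and "\<And>i j. i \<in> {1..l} \<Longrightarrow> j \<in> {1..l} \<Longrightarrow> commute_on (space M) (That i) (That j)"
    and "\<And>i j. i \<in> {1..l} \<Longrightarrow> j \<in> {1..l} \<Longrightarrow> commute_on (space M) (That i) (\<phi> (t j))"
    and "\<And>j. j \<in> {1..l} \<Longrightarrow> f j \<in> borel_measurable M"
    and "\<And>j. j \<in> {1..l} \<Longrightarrow> bounded (f j ` space M)"
  shows "tendsto_L2 M
    (\<lambda>N x. 1 / of_nat N *
       (\<Sum>n=0..N. \<Prod>j=1..l. f j ((That j ^^ N) ((\<phi> (t j) ^^ n) x))))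
    (\<lambda>x. \<Prod>j=1..l. (\<integral>y. f j y \<partial>M))"
proof -
  interpret prob_space M by fact
  interpret G: comm_group G using assms(3) by (simp add: free_abelian_def)
  interpret act: group_action G "space M" \<phi>
    using assms(5) by (simp add: measure_preserving_action_def)
  let ?X = "space M"
  have \<phi>_mp: "measure_preserving M (\<phi> g)" if "g \<in> carrier G" for g
    using assms(5) that by (simp add: measure_preserving_action_def)
  note \<phi>_X = measure_preserving_in_space[OF \<phi>_mp]
  have \<phi>_mult: "\<phi> g (\<phi> h x) = \<phi> (g \<otimes>\<^bsub>G\<^esub> h) x" if "g \<in> carrier G" "h \<in> carrier G" "x \<in> ?X" for g h x
    using act.composition_rule that by simp
  have \<phi>_one: "\<phi> \<one>\<^bsub>G\<^esub> x = x" if "x \<in> ?X" for x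
    using that by (simp flip: act.id_eq_one)
  have \<phi>_commute: "commute_on ?X (\<phi> g) (\<phi> h)" if "g \<in> carrier G" "h \<in> carrier G" for g h
    using that by (simp add: commute_on_def \<phi>_mult G.m_comm)
  have \<phi>_pow: "(\<phi> g ^^ n) ((\<phi> h ^^ n) x) = (\<phi> (g \<otimes>\<^bsub>G\<^esub> h) ^^ n) x"
    if "g \<in> carrier G" "h \<in> carrier G" "x \<in> ?X" for g h x n
  proof -
    have "(\<phi> g ^^ n) ((\<phi> h ^^ n) x) = ((\<lambda>x. \<phi> g (\<phi> h x)) ^^ n) x"
      by (rule funpow_comp_on[OF \<phi>_commute]) (use that \<phi>_X in auto)
    also have "\<dots> = (\<phi> (g \<otimes>\<^bsub>G\<^esub> h) ^^ n) x"
      by (rule funpow_cong_on[where X = ?X]) (use that \<phi>_mult \<phi>_X in auto)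
    finally show ?thesis .
  qed

  obtain That_inv where That_inv: "\<And>j. j \<in> {1..l} \<Longrightarrow> measure_preserving M (That_inv j)"
      "\<And>j x. j \<in> {1..l} \<Longrightarrow> x \<in> ?X \<Longrightarrow> That_inv j (That j x) = x"
      "\<And>j x. j \<in> {1..l} \<Longrightarrow> x \<in> ?X \<Longrightarrow> That j (That_inv j x) = x"
    using assms(10) unfolding invertible_measure_preserving_def by metis
  (* Index 0 is added for the identity: then P_j Q_0 is the map in the averages for j in {1..l}, and
     R_{0 j} is T_j itself. *)
  define \<tau> where "\<tau> j = (if j = 0 then \<one>\<^bsub>G\<^esub> else t j)" for j
  define S where "S j = (if j = 0 then (\<lambda>x. x) else That j)" for j
  define S' where "S' j = (if j = 0 then (\<lambda>x. x) else That_inv j)" for j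
  have \<tau>: "\<tau> j \<in> carrier G" if "j \<in> {0..l}" for j
    using assms(8)[of j] that by (auto simp: \<tau>_def)
  have \<tau>_inj: "\<tau> i \<noteq> \<tau> j" if "i \<in> {0..l}" "j \<in> {0..l}" "i \<noteq> j" for i j
    using that assms(8)[of i] assms(8)[of j] inj_onD[OF assms(9), of i j]
    by (auto simp: \<tau>_def)
  have S: "measure_preserving M (S j)" if "j \<in> {0..l}" for j
    using assms(10)[of j] that by (auto simp: S_def invertible_measure_preserving_def measure_preserving_id)
  have S': "measure_preserving M (S' j)" if "j \<in> {0..l}" for j
    using That_inv(1)[of j] that by (auto simp: S'_def measure_preserving_id)
  note S_X = measure_preserving_in_space[OF S] and S'_X = measure_preserving_in_space[OF S']
  have S_S': "S' j (S j x) = x" "S j (S' j x) = x" if "j \<in> {0..l}" "x \<in> ?X" for j x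
    using That_inv(2,3)[of j x] that by (auto simp: S_def S'_def)
  have S_\<tau>: "commute_on ?X (S j) (\<phi> (\<tau> i))" if "i \<in> {0..l}" "j \<in> {0..l}" for i j
  proof (cases "i = 0 \<or> j = 0")
    case True
    then show ?thesis
      using S_X[OF that(2)] by (auto simp: commute_on_def \<tau>_def S_def \<phi>_one)
  next
    case False
    then show ?thesis using assms(12)[of j i] that by (simp add: \<tau>_def S_def)
  qed
  (* S_j commutes with T_i, hence with its inverse, and so with R_{i j} *)
  have S_\<tau>_inv: "S j (\<phi> (inv\<^bsub>G\<^esub> \<tau> i) x) = \<phi> (inv\<^bsub>G\<^esub> \<tau> i) (S j x)"
    if "i \<in> {0..l}" "j \<in> {0..l}" "x \<in> ?X" for i j x
  proof -
    let ?y = "\<phi> (inv\<^bsub>G\<^esub> \<tau> i) x"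
    have y: "?y \<in> ?X" using \<tau> that by (intro \<phi>_X) auto
    have "S j ?y = \<phi> (inv\<^bsub>G\<^esub> \<tau> i) (\<phi> (\<tau> i) (S j ?y))"
      using \<tau>[OF that(1)] S_X[OF that(2) y] by (simp add: \<phi>_mult \<phi>_one)
    also have "\<phi> (\<tau> i) (S j ?y) = S j (\<phi> (\<tau> i) ?y)"
      using S_\<tau>[OF that(1,2)] y by (simp add: commute_on_def)
    also have "\<phi> (\<tau> i) ?y = x"
      using \<tau>[OF that(1)] that(3) by (simp add: \<phi>_mult \<phi>_one)
    finally show ?thesis .
  qed
  define P where "P j N n x = (S j ^^ N) ((\<phi> (\<tau> j) ^^ n) x)" for j N n x
  define Q where "Q j N n x = (\<phi> (inv\<^bsub>G\<^esub> \<tau> j) ^^ n) ((S' j ^^ N) x)" for j N n x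
  define R where "R i j = \<phi> (\<tau> j \<otimes>\<^bsub>G\<^esub> inv\<^bsub>G\<^esub> \<tau> i)" for i j

  have P_Q: "P j N n (Q i N n x) = (S j ^^ N) ((R i j ^^ n) ((S' i ^^ N) x))"
    if "i \<in> {0..l}" "j \<in> {0..l}" "x \<in> ?X" for i j N n x
    unfolding P_def Q_def R_def
    using \<tau> that funpow_in[of ?X "S' i", OF S'_X] by (subst \<phi>_pow) auto
  interpret mixing_family M "{0..l}" P Q R
  proof
    fix i j N n x assume j: "j \<in> {0..l}"
    show "measure_preserving M (P j N n)"
      unfolding P_def[abs_def]
      by (rule measure_preserving_comp[OF measure_preserving_funpow measure_preserving_funpow])
         (use j S \<phi>_mp \<tau> in auto)
    show "measure_preserving M (Q j N n)"
      unfolding Q_def[abs_def]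
      by (rule measure_preserving_comp[OF measure_preserving_funpow measure_preserving_funpow])
         (use j S' \<phi>_mp \<tau> in auto)
    show "P j N n (Q j N n x) = x" if x: "x \<in> ?X"
    proof -
      have "(R j j ^^ n) y = ((\<lambda>y. y) ^^ n) y" if "y \<in> ?X" for y
        unfolding R_def using \<tau>[OF j] that
        by (intro funpow_cong_on[where X = ?X]) (auto simp: \<phi>_one)
      moreover have "((\<lambda>y. y) ^^ n) y = y" for n and y :: 'a by (induction n) auto
      moreover have "commute_on ?X (S j) (S' j)" using S_S'[OF j] by (simp add: commute_on_def)
      then have "(S j ^^ N) ((S' j ^^ N) x) = ((\<lambda>y. S j (S' j y)) ^^ N) x"
        by (rule funpow_comp_on) (use j S_X S'_X x in auto)
      moreover have "\<dots> = ((\<lambda>y. y) ^^ N) x"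
        using S_S'[OF j] x by (intro funpow_cong_on[where X = ?X]) auto
      ultimately show ?thesis
        using P_Q[OF j j x] funpow_in[of ?X "S' j", OF S'_X[OF j] x] by simp
    qed
    assume i: "i \<in> {0..l}" and "i \<noteq> j"
    then have "\<tau> j \<otimes>\<^bsub>G\<^esub> inv\<^bsub>G\<^esub> \<tau> i \<noteq> \<one>\<^bsub>G\<^esub>"
      using \<tau>_inj[OF i j] \<tau>[OF i] \<tau>[OF j] G.inv_equality[of "\<tau> j" "inv\<^bsub>G\<^esub> \<tau> i"] by auto
    then show "weakly_mixing M (R i j)"
      using assms(6) \<tau>[OF i] \<tau>[OF j] unfolding R_def totally_weak_mixing_def by simp
    show "P j N (Suc n) (Q i N (Suc n) x) = R i j (P j N n (Q i N n x))" if x: "x \<in> ?X"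
    proof -
      have R_X: "R i j y \<in> ?X" if "y \<in> ?X" for y
        unfolding R_def using \<tau>[OF i] \<tau>[OF j] that by (intro \<phi>_X) auto
      have "R i j (S j y) = S j (R i j y)" if y: "y \<in> ?X" for y
      proof -
        have "R i j (S j y) = \<phi> (\<tau> j) (\<phi> (inv\<^bsub>G\<^esub> \<tau> i) (S j y))"
          unfolding R_def using \<tau>[OF i] \<tau>[OF j] S_X[OF j y] by (simp add: \<phi>_mult)
        also have "\<dots> = S j (\<phi> (\<tau> j) (\<phi> (inv\<^bsub>G\<^esub> \<tau> i) y))"
          using S_\<tau>[OF j j] S_\<tau>_inv[OF i j y] \<phi>_X[of "inv\<^bsub>G\<^esub> \<tau> i", OF _ y] \<tau>[OF i]
          by (simp add: commute_on_def)
        also have "\<dots> = S j (R i j y)"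
          unfolding R_def using \<tau>[OF i] \<tau>[OF j] y by (simp add: \<phi>_mult)
        finally show ?thesis .
      qed
      then have "commute_on ?X (R i j) (S j ^^ N)"
        by (intro commute_on_funpow S_X[OF j]) (auto simp: commute_on_def)
      moreover have "(R i j ^^ n) ((S' i ^^ N) x) \<in> ?X"
        by (intro funpow_in R_X S'_X[OF i] x)
      ultimately show ?thesis by (simp add: P_Q[OF i j x] commute_on_def)
    qed
  qed

  define c where "c = (\<Prod>j=1..l. \<integral>y. f j y \<partial>M)"
  define u where "u N n x = (\<Prod>j=1..l. f j ((That j ^^ N) ((\<phi> (t j) ^^ n) x)))" for N n x
  have f: "bounded_measurable M (f j)" if "j \<in> {1..l}" for j
    using assms(13,14)[OF that] by (auto simp: bounded_measurable_def bounded_iff)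
  have u_eq_P: "u N n x = (\<Prod>j=1..l. f j (P j N n x))" for N n x
    unfolding u_def P_def \<tau>_def S_def by (intro prod.cong) auto
  have u: "bounded_measurable M (u N n)" for N n
    unfolding u_eq_P[abs_def]
    by (rule bounded_measurable_prod) (rule bounded_measurable_compose[OF P f], auto)
  have "\<forall>j\<in>{1..l}. \<exists>B. \<forall>x\<in>?X. cmod (f j x) \<le> B"
    using f unfolding bounded_measurable_def by blast
  then obtain b where b: "\<And>j x. j \<in> {1..l} \<Longrightarrow> x \<in> ?X \<Longrightarrow> cmod (f j x) \<le> b j" by metis
  define B where "B = (\<Prod>j=1..l. b j)"
  have u_bound: "cmod (u N n x) \<le> B" if "x \<in> ?X" for N n x
    unfolding u_eq_P B_def prod_norm[symmetric]
    using that by (intro prod_mono conjI norm_ge_zero b measure_preserving_in_space[OF P]) auto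
  have Q_0: "Q 0 N n x = x" if "x \<in> ?X" for N n x
  proof -
    have one: "((\<lambda>y. y) ^^ n) y = y" for n and y :: 'a by (induction n) auto
    have "(\<phi> \<one>\<^bsub>G\<^esub> ^^ n) x = ((\<lambda>y. y) ^^ n) x"
      using that by (intro funpow_cong_on[where X = ?X]) (auto simp: \<phi>_one)
    then show ?thesis by (simp add: Q_def \<tau>_def S'_def one)
  qed

  define A where "A N x = (\<Sum>n<N. u N n x) / of_nat N" for N x
  have "bounded_measurable M (\<lambda>x. (\<Sum>n<N. u N n x) * (1 / of_nat N) - c)" for N
    by (intro bounded_measurable_diff bounded_measurable_mult bounded_measurable_sum
        bounded_measurable_const u)
  then have A: "bounded_measurable M (\<lambda>x. A N x - c)" for N by (simp add: A_def)
  have A_lim: "(\<lambda>N. \<integral>x. (cmod (A N x - c))\<^sup>2 \<partial>M) \<longlonglongrightarrow> 0"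
  proof -
    have "(\<lambda>N. \<integral>x. (cmod ((\<Sum>n<N. \<Prod>j\<in>{1..l}. f j (P j N n (Q 0 N n x))) / of_nat N - c))\<^sup>2 \<partial>M) \<longlonglongrightarrow> 0"
      unfolding c_def by (rule L2_convergence) (auto intro: f)
    then show ?thesis
      by (simp add: A_def u_eq_P Q_0 cong: Bochner_Integration.integral_cong)
  qed
  define F where "F N x = 1 / of_nat N * (\<Sum>n=0..N. u N n x)" for N x
  have F: "bounded_measurable M (F N)" for N
    unfolding F_def[abs_def]
    by (intro bounded_measurable_mult bounded_measurable_sum bounded_measurable_const u)
  have F_c: "bounded_measurable M (\<lambda>x. F N x - c)" for N
    by (intro bounded_measurable_diff bounded_measurable_const F)
  (* The sum in F has one term more than A, the term n = N; it contributes at most B / N. *)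
  have bound: "(\<integral>x. (cmod (F N x - c))\<^sup>2 \<partial>M) \<le> 2 * (\<integral>x. (cmod (A N x - c))\<^sup>2 \<partial>M) + 2 * (B / real N)\<^sup>2" for N
  proof -
    have "(\<integral>x. (cmod (F N x - c))\<^sup>2 \<partial>M) \<le> (\<integral>x. 2 * (cmod (A N x - c))\<^sup>2 + 2 * (B / real N)\<^sup>2 \<partial>M)"
    proof (rule integral_mono)
      fix x assume x: "x \<in> ?X"
      have "F N x - c = (A N x - c) + u N N x / of_nat N"
        by (simp add: F_def A_def atLeast0AtMost add_divide_distrib flip: lessThan_Suc_atMost)
      then have "cmod (F N x - c) \<le> cmod (A N x - c) + cmod (u N N x / of_nat N)"
        by (metis norm_triangle_ineq)
      also have "cmod (u N N x / of_nat N) \<le> B / real N"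
        using u_bound[OF x] by (simp add: norm_divide divide_right_mono)
      finally have "(cmod (F N x - c))\<^sup>2 \<le> (cmod (A N x - c) + B / real N)\<^sup>2"
        by (intro power_mono) auto
      also have "\<dots> \<le> 2 * (cmod (A N x - c))\<^sup>2 + 2 * (B / real N)\<^sup>2"
        using sum_squares_bound[of "cmod (A N x - c)" "B / real N"] unfolding power2_sum by linarith
      finally show "(cmod (F N x - c))\<^sup>2 \<le> 2 * (cmod (A N x - c))\<^sup>2 + 2 * (B / real N)\<^sup>2" .
    qed (use integrable_bounded_measurable[OF bounded_measurable_cmod_square[OF A]]
          integrable_bounded_measurable[OF bounded_measurable_cmod_square[OF F_c]] in simp_all)
    also have "\<dots> = 2 * (\<integral>x. (cmod (A N x - c))\<^sup>2 \<partial>M) + 2 * (B / real N)\<^sup>2"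
      using integrable_bounded_measurable[OF bounded_measurable_cmod_square[OF A]]
      by (simp add: prob_space)
    finally show ?thesis .
  qed
  have "(\<lambda>N. 2 * (\<integral>x. (cmod (A N x - c))\<^sup>2 \<partial>M) + 2 * (B / real N)\<^sup>2) \<longlonglongrightarrow> 2 * 0 + 2 * 0\<^sup>2"
    by (intro tendsto_intros A_lim lim_const_over_n)
  then have "(\<lambda>N. 2 * (\<integral>x. (cmod (A N x - c))\<^sup>2 \<partial>M) + 2 * (B / real N)\<^sup>2) \<longlonglongrightarrow> 0" by simp
  then have "(\<lambda>N. \<integral>x. (cmod (F N x - c))\<^sup>2 \<partial>M) \<longlonglongrightarrow> 0"
    by (rule tendsto_sandwich[OF _ _ tendsto_const, rotated 2])
       (auto intro!: always_eventually bound)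
  from tendsto_real_sqrt[OF this]
  have "(\<lambda>N. sqrt (\<integral>x. (cmod (F N x - c))\<^sup>2 \<partial>M)) \<longlonglongrightarrow> 0" by simp
  moreover have sq: "square_integrable M g" if "bounded_measurable M g" for g :: "'a \<Rightarrow> complex"
    unfolding square_integrable_def
    using bounded_measurable_measurable[OF that]
      integrable_bounded_measurable[OF bounded_measurable_cmod_square[OF that]] by simp
  ultimately have "tendsto_L2 M F (\<lambda>x. c)"
    unfolding tendsto_L2_def using F bounded_measurable_const by blast
  then show ?thesis unfolding F_def[abs_def] u_def c_def .
qed

end
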